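(* Let $d>2$ be an integer, let $p\in[0,1]$, and let $W_p:\mathcal{M}_d\to\mathcal{M}_d$ be the Werner map with parameter $p$. The map $W_p\otimes(\vartheta_d\circ W_p)$ is positive and non-decomposable if and only if $$\frac{(2-\sqrt3)(d+1)}{2(d+1-\sqrt3)}\ \leq\ p\ <\ \frac{1}{2+\sqrt{\frac{2d}{d+1}}}.$$
   Context: $\mathcal{M}_d$ denotes the complex $d\times d$ matrices and $\vartheta_d$ the transposition on $\mathcal{M}_d$ in the computational basis. A linear map is positive if it maps positive semidefinite matrices to positive semidefinite matrices. A linear map $L:\mathcal{M}_{D}\to\mathcal{M}_{D'}$ is decomposable if $L=T_1+\vartheta_{D'}\circ T_2$ with $T_1,T_2$ completely positive; here $\mathcal{M}_d\otimes\mathcal{M}_d\cong\mathcal{M}_{d^2}$. The Choi matrix of $L:\mathcal{M}_d\to\mathcal{M}_d$ is $C_L=(\mathrm{id}_d\otimes L)(\omega_d)$ with $\omega_d=\sum_{i,j}|i\rangle\langle j|\otimes|i\rangle\langle j|$. With the flip $\mathbb{F}_d(|i\rangle\otimes|j\rangle)=|j\rangle\otimes|i\rangle$, set $P_{\mathrm{sym}}=\frac12(\mathbb{1}_d\otimes\mathbb{1}_d+\mathbb{F}_d)$, $P_{\mathrm{asym}}=\frac12(\mathbb{1}_d\otimes\mathbb{1}_d-\mathbb{F}_d)$, $d_{\mathrm{sym}}=d(d+1)/2$, $d_{\mathrm{asym}}=d(d-1)/2$. The Werner map $W_p:\mathcal{M}_d\to\mathcal{M}_d$, $p\in[0,1]$,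 is the linear map with Choi matrix $C_{W_p}=\rho_W(p):=p\,P_{\mathrm{sym}}/d_{\mathrm{sym}}+(1-p)\,P_{\mathrm{asym}}/d_{\mathrm{asym}}$. *)

theory Defs
  imports "HOL-Analysis.Analysis"
begin

text \<open>
  Complex \<open>d \<times> d\<close> matrices are elements of \<open>complex ^ 'n ^ 'n\<close> with \<open>d = CARD('n)\<close>; the
  standard basis vectors indexed by \<open>'n\<close> are the computational basis.  The identification of
  the tensor product of two matrix algebras with a matrix algebra uses the product index type
  \<open>'n \<times> 'm\<close>, whose cardinality is \<open>CARD('n) * CARD('m)\<close>.
\<close>

type_synonym 'n cmat = "complex ^ 'n ^ 'n"

text \<open>The library operator \<open>*s\<close> on vectors does not provide scalar multiplication of matrices.\<close>

definition smult_mat :: "complex \<Rightarrow> 'n::finite cmat \<Rightarrow> 'n cmat" where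
  "smult_mat c A = (\<chi> i j. c * A $ i $ j)"

abbreviation complex_linear :: "('n::finite cmat \<Rightarrow> 'm::finite cmat) \<Rightarrow> bool" where
  "complex_linear \<equiv> Vector_Spaces.linear smult_mat smult_mat"

definition psd :: "'n::finite cmat \<Rightarrow> bool" where
  "psd A \<longleftrightarrow> (\<forall>v :: complex ^ 'n. (\<Sum>i\<in>UNIV. cnj (v $ i) * (A *v v) $ i) \<in> \<real>\<^sub>\<ge>\<^sub>0)"

definition positive_map :: "('n::finite cmat \<Rightarrow> 'm::finite cmat) \<Rightarrow> bool" where
  "positive_map L \<longleftrightarrow> complex_linear L \<and> (\<forall>A. psd A \<longrightarrow> psd (L A))"

text \<open>
  A \<open>k \<times> k\<close> block matrix with blocks \<open>B r s\<close> for \<open>r, s < k\<close> represents an element of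
  \<open>M\<^sub>k \<otimes> M\<^sub>d\<close>.  Blocks are used since \<open>k\<close> is quantified over inside the definition of
  complete positivity; the map \<open>id\<^sub>k \<otimes> L\<close> then applies \<open>L\<close> to every block.
\<close>

definition psd_block :: "nat \<Rightarrow> (nat \<Rightarrow> nat \<Rightarrow> 'n::finite cmat) \<Rightarrow> bool" where
  "psd_block k B \<longleftrightarrow> (\<forall>v :: nat \<Rightarrow> complex ^ 'n.
     (\<Sum>r<k. \<Sum>s<k. \<Sum>i\<in>UNIV. cnj (v r $ i) * (B r s *v v s) $ i) \<in> \<real>\<^sub>\<ge>\<^sub>0)"

definition completely_positive :: "('n::finite cmat \<Rightarrow> 'm::finite cmat) \<Rightarrow> bool" where
  "completely_positive L \<longleftrightarrow> complex_linear L \<and>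
     (\<forall>k B. psd_block k B \<longrightarrow> psd_block k (\<lambda>r s. L (B r s)))"

definition decomposable :: "('n::finite cmat \<Rightarrow> 'm::finite cmat) \<Rightarrow> bool" where
  "decomposable L \<longleftrightarrow> (\<exists>T1 T2. completely_positive T1 \<and> completely_positive T2 \<and>
     L = (\<lambda>X. T1 X + transpose (T2 X)))"

definition matrix_unit :: "'n \<Rightarrow> 'n \<Rightarrow> 'n::finite cmat" where
  "matrix_unit a b = (\<chi> i j. if i = a \<and> j = b then 1 else 0)"

definition tensor_mat :: "'n::finite cmat \<Rightarrow> 'm::finite cmat \<Rightarrow> ('n \<times> 'm) cmat" where
  "tensor_mat A B = (\<chi> p q. A $ fst p $ fst q * B $ snd p $ snd q)"

text \<open>
  The tensor product of two linear maps, by expanding its argument in the product basis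
  \<open>E\<^sub>a\<^sub>b \<otimes> E\<^sub>c\<^sub>e\<close>.  The lemmas \<open>complex_linear_tensor_map\<close>, \<open>tensor_map_tensor_mat\<close> and
  \<open>tensor_map_unique\<close> below give its characteristic property.
\<close>

definition tensor_map ::
  "('n::finite cmat \<Rightarrow> 'n'::finite cmat) \<Rightarrow> ('m::finite cmat \<Rightarrow> 'm'::finite cmat)
    \<Rightarrow> ('n \<times> 'm) cmat \<Rightarrow> ('n' \<times> 'm') cmat" where
  "tensor_map L M X = (\<Sum>a\<in>UNIV. \<Sum>b\<in>UNIV. \<Sum>c\<in>UNIV. \<Sum>e\<in>UNIV.
     smult_mat (X $ (a, c) $ (b, e)) (tensor_mat (L (matrix_unit a b)) (M (matrix_unit c e))))"

definition omega :: "('n::finite \<times> 'n) cmat" where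
  "omega = (\<Sum>i\<in>UNIV. \<Sum>j\<in>UNIV. tensor_mat (matrix_unit i j) (matrix_unit i j))"

definition choi :: "('n::finite cmat \<Rightarrow> 'n cmat) \<Rightarrow> ('n \<times> 'n) cmat" where
  "choi L = tensor_map id L omega"

definition flip_mat :: "('n::finite \<times> 'n) cmat" where
  "flip_mat = (\<chi> p q. if p = prod.swap q then 1 else 0)"

definition P_sym :: "('n::finite \<times> 'n) cmat" where
  "P_sym = (1/2) *\<^sub>R (mat 1 + flip_mat)"

definition P_asym :: "('n::finite \<times> 'n) cmat" where
  "P_asym = (1/2) *\<^sub>R (mat 1 - flip_mat)"

definition d_sym :: "nat \<Rightarrow> real" where
  "d_sym d = real d * (real d + 1) / 2"

definition d_asym :: "nat \<Rightarrow> real" where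
  "d_asym d = real d * (real d - 1) / 2"

definition werner_state :: "real \<Rightarrow> ('n::finite \<times> 'n) cmat" where
  "werner_state p = (p / d_sym CARD('n)) *\<^sub>R P_sym + ((1 - p) / d_asym CARD('n)) *\<^sub>R P_asym"

text \<open>Existence and uniqueness are shown in \<open>ex1_choi\<close> below.\<close>

definition werner_map :: "real \<Rightarrow> 'n::finite cmat \<Rightarrow> 'n cmat" where
  "werner_map p = (THE L. complex_linear L \<and> choi L = werner_state p)"


subsection \<open>Basic facts\<close>

lemma smult_mat_nth [simp]: "smult_mat c A $ i $ j = c * A $ i $ j"
  by (simp add: smult_mat_def)

lemma matrix_unit_nth [simp]: "matrix_unit a b $ i $ j = (if i = a \<and> j = b then 1 else 0)"
  by (simp add: matrix_unit_def)

lemma tensor_mat_nth [simp]: "tensor_mat A B $ (i, k) $ (j, l) = A $ i $ j * B $ k $ l"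
  by (simp add: tensor_mat_def)

lemma vector_space_smult_mat: "vector_space smult_mat"
  by unfold_locales (auto simp: vec_eq_iff algebra_simps)

lemma complex_linear_iff:
  "complex_linear L \<longleftrightarrow> (\<forall>A B. L (A + B) = L A + L B) \<and> (\<forall>c A. L (smult_mat c A) = smult_mat c (L A))"
  unfolding Vector_Spaces.linear_def module_hom_def module_hom_axioms_def
  using vector_space_smult_mat[unfolded module_iff_vector_space[symmetric]]
        vector_space_smult_mat
  by (auto simp: module_iff_vector_space)

lemma complex_linear_sum:
  assumes "complex_linear L"
  shows "L (\<Sum>x\<in>S. f x) = (\<Sum>x\<in>S. L (f x))"
proof -
  interpret Vector_Spaces.linear smult_mat smult_mat L by (rule assms)
  show ?thesis by (rule sum)
qed

lemma matrix_unit_expansion: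
  "(A :: 'n::finite cmat) = (\<Sum>i\<in>UNIV. \<Sum>j\<in>UNIV. smult_mat (A $ i $ j) (matrix_unit i j))"
proof -
  have "(\<Sum>i\<in>UNIV. \<Sum>j\<in>UNIV. A $ i $ j * (if k = i \<and> l = j then 1 else 0)) = A $ k $ l" for k l
  proof -
    have "(\<Sum>j\<in>UNIV. A $ i $ j * (if k = i \<and> l = j then 1 else 0)) = (if k = i then A $ i $ l else 0)" for i
      by (cases "k = i") (simp_all add: if_distrib cong: if_cong)
    then show ?thesis by simp
  qed
  then show ?thesis by (simp add: vec_eq_iff)
qed

lemma complex_linear_expansion:
  assumes "complex_linear L"
  shows "L A = (\<Sum>i\<in>UNIV. \<Sum>j\<in>UNIV. smult_mat (A $ i $ j) (L (matrix_unit i j)))"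
  by (subst matrix_unit_expansion[of A])
     (use assms in \<open>simp add: complex_linear_sum complex_linear_iff\<close>)

lemma complex_linear_tensor_map: "complex_linear (tensor_map L M)"
  by (auto simp: complex_linear_iff tensor_map_def vec_eq_iff sum.distrib sum_distrib_left algebra_simps)

lemma tensor_map_tensor_mat:
  fixes L :: "'a::finite cmat \<Rightarrow> 'b::finite cmat" and M :: "'c::finite cmat \<Rightarrow> 'd::finite cmat"
  assumes "complex_linear L" and "complex_linear M"
  shows "tensor_map L M (tensor_mat A B) = tensor_mat (L A) (M B)"
proof -
  have prod: "(\<Sum>a\<in>UNIV. \<Sum>b\<in>UNIV. f a b) * (\<Sum>c\<in>UNIV. \<Sum>e\<in>UNIV. g c e) =
      (\<Sum>a\<in>UNIV. \<Sum>b\<in>UNIV. \<Sum>c\<in>UNIV. \<Sum>e\<in>UNIV. f a b * g c e)"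
    for f :: "'a \<Rightarrow> 'a \<Rightarrow> complex" and g :: "'c \<Rightarrow> 'c \<Rightarrow> complex"
    by (simp only: sum_distrib_right) (simp only: sum_distrib_left)
  have "tensor_mat (L A) (M B) $ (i, k) $ (j, l) =
      tensor_map L M (tensor_mat A B) $ (i, k) $ (j, l)" for i j k l
    unfolding tensor_mat_nth complex_linear_expansion[OF assms(1), of A]
      complex_linear_expansion[OF assms(2), of B]
    by (simp add: prod tensor_map_def mult_ac)
  then show ?thesis by (simp add: vec_eq_iff)
qed

lemma tensor_map_unique:
  fixes L :: "'a::finite cmat \<Rightarrow> 'b::finite cmat" and M :: "'c::finite cmat \<Rightarrow> 'd::finite cmat"
  assumes "complex_linear N" and "\<And>A B. N (tensor_mat A B) = tensor_mat (L A) (M B)"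
  shows "N = tensor_map L M"
proof
  fix X
  have unit: "matrix_unit (a, c) (b, e) = tensor_mat (matrix_unit a b) (matrix_unit c e)"
    for a b :: 'a and c e :: 'c
    by (auto simp: vec_eq_iff)
  have pair: "(\<Sum>p\<in>UNIV. f p) = (\<Sum>a\<in>UNIV. \<Sum>c\<in>UNIV. f (a, c))"
    for f :: "'a \<times> 'c \<Rightarrow> ('b \<times> 'd) cmat"
    unfolding UNIV_Times_UNIV[symmetric] sum.cartesian_product by simp
  have "N X = (\<Sum>p\<in>UNIV. \<Sum>q\<in>UNIV. smult_mat (X $ p $ q) (N (matrix_unit p q)))"
    by (rule complex_linear_expansion[OF assms(1)])
  also have "\<dots> = (\<Sum>a\<in>UNIV. \<Sum>c\<in>UNIV. \<Sum>b\<in>UNIV. \<Sum>e\<in>UNIV.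
      smult_mat (X $ (a, c) $ (b, e)) (tensor_mat (L (matrix_unit a b)) (M (matrix_unit c e))))"
    by (simp only: pair unit assms(2))
  also have "\<dots> = tensor_map L M X"
    unfolding tensor_map_def by (intro sum.cong refl sum.swap)
  finally show "N X = tensor_map L M X" .
qed

lemma flip_mat_tensor_basis:
  "flip_mat *v (axis (i, j) 1) = axis (j, i) (1 :: complex)"
proof -
  have "(flip_mat *v axis (i, j) 1) $ p = axis (j, i) (1 :: complex) $ p" for p :: "'a \<times> 'a"
  proof -
    have "(flip_mat *v axis (i, j) 1) $ p = (\<Sum>q\<in>UNIV. if q = (i, j) then if p = (j, i) then 1 else 0 else 0 :: complex)"
      unfolding matrix_vector_mult_def flip_mat_def axis_def vec_lambda_beta by (intro sum.cong refl) auto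
    also have "\<dots> = axis (j, i) 1 $ p" by (simp add: axis_def)
    finally show ?thesis .
  qed
  then show ?thesis by (simp only: vec_eq_iff) simp
qed

lemma choi_nth: "choi L $ (i, k) $ (j, l) = L (matrix_unit i j) $ k $ l"
proof -
  have om: "omega $ (a, c) $ (b, e) = (if c = a then if e = b then 1 else 0 else 0)"
    for a b c e :: 'a
  proof -
    have "(omega :: ('a \<times> 'a) cmat) $ (a, c) $ (b, e) =
        (\<Sum>i\<in>UNIV. \<Sum>j\<in>UNIV. if i = a then if j = b then if c = a then if e = b then 1 else 0 else 0 else 0 else 0)"
      by (auto simp: omega_def intro!: sum.cong)
    also have "\<dots> = (\<Sum>i\<in>UNIV. if i = a then (\<Sum>j\<in>UNIV. if j = b then if c = a then if e = b then 1 else 0 else 0 else 0) else 0)"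
      by (intro sum.cong) auto
    finally show ?thesis by simp
  qed
  have "choi L = (\<Sum>a\<in>UNIV. \<Sum>b\<in>UNIV. \<Sum>c\<in>UNIV. \<Sum>e\<in>UNIV.
     if c = a then if e = b then tensor_mat (matrix_unit a b) (L (matrix_unit c e)) else 0 else 0)"
    unfolding choi_def tensor_map_def om by (intro sum.cong refl) (auto simp: vec_eq_iff)
  also have "\<dots> = (\<Sum>a\<in>UNIV. \<Sum>b\<in>UNIV. \<Sum>c\<in>UNIV. if c = a then (\<Sum>e\<in>UNIV.
     if e = b then tensor_mat (matrix_unit a b) (L (matrix_unit c e)) else 0) else 0)"
    by (intro sum.cong refl) auto
  also have "\<dots> = (\<Sum>a\<in>UNIV. \<Sum>b\<in>UNIV. tensor_mat (matrix_unit a b) (L (matrix_unit a b)))"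
    by simp
  finally have "choi L $ (i, k) $ (j, l) = (\<Sum>a\<in>UNIV. \<Sum>b\<in>UNIV.
      if a = i then if b = j then L (matrix_unit a b) $ k $ l else 0 else 0)"
    by (auto intro!: sum.cong)
  also have "\<dots> = (\<Sum>a\<in>UNIV. if a = i then (\<Sum>b\<in>UNIV. if b = j then L (matrix_unit a b) $ k $ l else 0) else 0)"
    by (intro sum.cong) auto
  finally show ?thesis by simp
qed

lemma ex1_choi: "\<exists>!L. complex_linear L \<and> choi L = C"
proof (rule ex_ex1I)
  define L where "L X = (\<chi> k l. \<Sum>i\<in>UNIV. \<Sum>j\<in>UNIV. X $ i $ j * C $ (i, k) $ (j, l))" for X :: "'a cmat"
  have lin: "complex_linear L"
    by (auto simp: complex_linear_iff L_def vec_eq_iff sum.distrib sum_distrib_left algebra_simps)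
  have "L (matrix_unit a b) $ k $ l = C $ (a, k) $ (b, l)" for a b k l
  proof -
    have "L (matrix_unit a b) $ k $ l =
        (\<Sum>i\<in>UNIV. \<Sum>j\<in>UNIV. if i = a then if j = b then C $ (i, k) $ (j, l) else 0 else 0)"
      unfolding L_def by (auto intro!: sum.cong)
    also have "\<dots> = (\<Sum>i\<in>UNIV. if i = a then (\<Sum>j\<in>UNIV. if j = b then C $ (i, k) $ (j, l) else 0) else 0)"
      by (intro sum.cong) auto
    finally show ?thesis by simp
  qed
  then have "choi L = C" by (auto simp: vec_eq_iff choi_nth)
  with lin show "\<exists>L. complex_linear L \<and> choi L = C" by blast
next
  fix L M :: "'a cmat \<Rightarrow> 'a cmat"
  assume L: "complex_linear L \<and> choi L = C" and M: "complex_linear M \<and> choi M = C"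
  have "L (matrix_unit i j) = M (matrix_unit i j)" for i j
    using L M by (simp add: vec_eq_iff flip: choi_nth)
  then show "L = M"
    using complex_linear_expansion L M by (metis (no_types, lifting) ext sum.cong)
qed

lemma complex_linear_werner_map: "complex_linear (werner_map p)"
  and choi_werner_map: "choi (werner_map p) = werner_state p"
  using theI'[OF ex1_choi, of "werner_state p"] unfolding werner_map_def by auto

end

theory Submission
  imports Defs
begin

text \<open>
  Let \<open>\<rho> = a \<cdot> 1 + b F\<close> be the Choi matrix of \<open>W\<close>, with \<open>F\<close> the flip, and let
  \<open>\<omega> = F\<^sup>\<Gamma>\<close> be its partial transpose.  Up to reordering the tensor factors, the Choi matrix of
  \<open>W \<otimes> (\<vartheta> \<circ> W)\<close> is \<open>C = (a \<cdot> 1 + b F) \<otimes> (a \<cdot> 1 + b \<omega>)\<close>.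

  Decomposability means \<open>C = P + Q\<^sup>\<Gamma>\<close> with \<open>P, Q \<ge> 0\<close>.  By symmetry, \<open>P\<close> can be sought in the span
  of \<open>{1, F} \<otimes> {1, \<omega>}\<close> and \<open>Q\<close> in that of \<open>{1, \<omega>} \<otimes> {1, F}\<close>, which leaves a linear program in
  four variables.  Its optimal primal and dual solutions give an explicit decomposition above the
  upper threshold and an explicit witness with positive partial transpose below it.

  Positivity asks for \<open>C\<close> to be nonnegative on vectors \<open>x \<otimes> y\<close>.  Viewing \<open>x, y\<close> as matrices
  \<open>X, Y\<close> and writing \<open>X = U diag(m) V\<^sup>*\<close>, the entries \<open>N\<^sub>i\<^sub>j\<close> of \<open>U\<^sup>T Y V\<close> decouple: the form is a sum over
  pairs \<open>{i, j}\<close> of quadratic forms in \<open>N\<^sub>i\<^sub>j, N\<^sub>j\<^sub>i\<close>, all of which are nonnegative if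
  \<open>b\<^sup>2 \<le> 2 a (a + b)\<close> (for \<open>b \<le> 0\<close>); a maximally entangled \<open>x\<close> and a singlet \<open>y\<close> on a
  two-dimensional subspace show that this condition is necessary.
\<close>

subsection \<open>Singular values and positive semidefinite matrices\<close>

definition cip :: "complex ^ 'n::finite \<Rightarrow> complex ^ 'n \<Rightarrow> complex" where
  "cip x y = (\<Sum>i\<in>UNIV. cnj (x $ i) * y $ i)"

definition dagger :: "complex ^ 'n ^ 'm \<Rightarrow> complex ^ 'm ^ 'n" where
  "dagger A = (\<chi> i j. cnj (A $ j $ i))"

definition cnj_mat :: "complex ^ 'n ^ 'm \<Rightarrow> complex ^ 'n ^ 'm" where
  "cnj_mat A = (\<chi> i j. cnj (A $ i $ j))"

lemma dagger_nth [simp]: "dagger A $ i $ j = cnj (A $ j $ i)"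
  by (simp add: dagger_def)

lemma cnj_mat_nth [simp]: "cnj_mat A $ i $ j = cnj (A $ i $ j)"
  by (simp add: cnj_mat_def)

lemma dagger_dagger [simp]: "dagger (dagger A) = A"
  by (simp add: vec_eq_iff)

lemma dagger_mult: "dagger (A ** B) = dagger B ** dagger A"
  by (simp add: vec_eq_iff matrix_matrix_mult_def mult.commute)

lemma cip_self: "cip x x = of_real ((norm x)\<^sup>2)"
  by (simp add: cip_def norm_vec_def L2_set_def sum_nonneg complex_norm_square mult.commute flip: of_real_power)

lemma cip_self_eq_0 [simp]: "cip x x = 0 \<longleftrightarrow> x = 0"
  by (simp add: cip_self)

lemma cip_cnj: "cnj (cip x y) = cip y x"
  by (simp add: cip_def mult.commute)

lemma cip_add_left: "cip (x + y) z = cip x z + cip y z"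
  and cip_add_right: "cip x (y + z) = cip x y + cip x z"
  and cip_diff_right: "cip x (y - z) = cip x y - cip x z"
  and cip_smult_left: "cip (c *s x) y = cnj c * cip x y"
  and cip_smult_right: "cip x (c *s y) = c * cip x y"
  by (simp_all add: cip_def algebra_simps sum.distrib sum_subtractf sum_distrib_left)

lemma cip_zero [simp]: "cip 0 x = 0" "cip x 0 = 0"
  by (simp_all add: cip_def)

lemma cip_dagger: "cip x (dagger A *v y) = cip (A *v x) y"
proof -
  have "cip x (dagger A *v y) = (\<Sum>i\<in>UNIV. \<Sum>j\<in>UNIV. cnj (x $ i) * cnj (A $ j $ i) * y $ j)"
    by (simp add: cip_def matrix_vector_mult_def sum_distrib_left mult.assoc)
  also have "\<dots> = cip (A *v x) y"
    by (subst sum.swap) (simp add: cip_def matrix_vector_mult_def sum_distrib_right sum_distrib_left mult_ac)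
  finally show ?thesis .
qed

lemma cip_mult_right: "cip x (A *v y) = cip (dagger A *v x) y"
  using cip_dagger[of x "dagger A" y] by simp

lemma norm_smult_vec: "norm (c *s x) = norm c * norm (x :: complex ^ 'n::finite)"
  by (simp add: norm_vec_def norm_mult L2_set_right_distrib)

lemma norm_normalise:
  assumes "x \<noteq> (0 :: complex ^ 'n::finite)"
  shows "norm (of_real (1 / norm x) *s x) = 1"
  using assms by (simp only: norm_smult_vec norm_of_real) simp

section \<open>Singular value decomposition by successive constrained maximisation\<close>

lemma continuous_on_cip [continuous_intros]:
  fixes f :: "'a::topological_space \<Rightarrow> complex ^ 'n::finite"
  assumes "continuous_on S f"
  shows "continuous_on S (\<lambda>x. cip y (f x))"
  unfolding cip_def by (intro continuous_intros assms)

text \<open>The orthogonality conditions are the rows of a square matrix, filled up with zero rows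
  outside \<open>S\<close>. Row \<open>k\<close> is zero, so the determinant vanishes and a kernel
  vector can be normalised.\<close>

lemma ex_unit_orthogonal:
  fixes v :: "'n::finite \<Rightarrow> complex ^ 'n"
  assumes "k \<notin> S"
  shows "\<exists>x. norm x = 1 \<and> (\<forall>i\<in>S. cip (v i) x = 0)"
proof -
  define A :: "'n cmat" where "A = (\<chi> i j. if i \<in> S then cnj (v i $ j) else 0)"
  have "row k A = 0"
    using assms by (simp add: A_def row_def vec_eq_iff)
  then have "det A = 0"
    using det_row_0 by (simp add: det_zero_row)
  then have "\<not> (\<exists>B. B ** A = mat 1)"
    by (metis invertible_det_nz invertible_left_inverse)
  then obtain x where x: "A *v x = 0" "x \<noteq> 0"
    using matrix_left_invertible_ker by blast
  define y where "y = of_real (1 / norm x) *s x"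
  have "norm y = 1"
    unfolding y_def by (rule norm_normalise) (rule x)
  moreover have "cip (v i) y = 0" if "i \<in> S" for i
  proof -
    have "cip (v i) x = (A *v x) $ i"
      using that by (simp add: A_def cip_def matrix_vector_mult_def)
    then show ?thesis
      using x by (simp add: y_def cip_smult_right)
  qed
  ultimately show ?thesis by blast
qed

text \<open>
  The first-order condition for the maximum: the perturbation \<open>z + e g\<close> by the defect
  \<open>g = K\<^sup>* K z - \<parallel>K z\<parallel>\<^sup>2 z\<close> would increase \<open>\<parallel>K x\<parallel> / \<parallel>x\<parallel>\<close> unless \<open>g = 0\<close>.
\<close>

lemma maximiser_singular:
  fixes K :: "'n::finite cmat"
  assumes z: "norm z = 1" "\<And>i. i \<in> S \<Longrightarrow> cip (v i) z = 0"
    and max: "\<And>x. norm x = 1 \<Longrightarrow> (\<And>i. i \<in> S \<Longrightarrow> cip (v i) x = 0) \<Longrightarrow> norm (K *v x) \<le> norm (K *v z)"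
    and g: "\<And>i. i \<in> S \<Longrightarrow> cip (v i) (dagger K *v (K *v z)) = 0"
  shows "dagger K *v (K *v z) = of_real ((norm (K *v z))\<^sup>2) *s z"
proof -
  define t where "t = norm (K *v z)"
  define g where "g = dagger K *v (K *v z) - of_real (t\<^sup>2) *s z"
  have gorth: "cip (v i) g = 0" if "i \<in> S" for i
    using that z(2) assms(4) by (simp add: g_def cip_diff_right cip_smult_right)
  \<comment> \<open>Homogeneity extends the maximality from unit vectors to all vectors satisfying
    the constraints, among them the perturbed vector.\<close>
  have bound: "(norm (K *v x))\<^sup>2 \<le> t\<^sup>2 * (norm x)\<^sup>2" if "\<And>i. i \<in> S \<Longrightarrow> cip (v i) x = 0" for x
  proof (cases "x = 0")
    case False
    define y where "y = of_real (1 / norm x) *s x"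
    have "norm y = 1"
      unfolding y_def by (rule norm_normalise) (rule False)
    moreover have "cip (v i) y = 0" if "i \<in> S" for i
      using that \<open>\<And>i. i \<in> S \<Longrightarrow> cip (v i) x = 0\<close> by (simp add: y_def cip_smult_right)
    ultimately have "norm (K *v y) \<le> t"
      using max by (simp add: t_def)
    moreover have "norm (K *v y) = norm (K *v x) / norm x"
      unfolding y_def vector_scalar_commute norm_smult_vec norm_of_real by simp
    ultimately have "norm (K *v x) \<le> t * norm x"
      using False by (simp add: field_simps)
    then show ?thesis
      using power_mono[of "norm (K *v x)" "t * norm x" 2] by (simp add: power_mult_distrib)
  qed simp
  \<comment> \<open>A step size with \<open>e * t\<^sup>2 < 1\<close>, also for
    \<open>t = 0\<close>: the first-order gain then outweighs the second-order loss.\<close>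
  define e where "e = 1 / (t\<^sup>2 + 1)"
  have e: "e > 0" "e * t\<^sup>2 < 1"
    by (simp_all add: e_def add_nonneg_pos)
  have sq: "(norm (x + of_real e *s y))\<^sup>2 = (norm x)\<^sup>2 + 2 * e * Re (cip y x) + e\<^sup>2 * (norm y)\<^sup>2"
    for x y :: "complex ^ 'n"
  proof -
    have "complex_of_real ((norm (x + of_real e *s y))\<^sup>2) = cip (x + of_real e *s y) (x + of_real e *s y)"
      by (simp add: cip_self)
    also have "\<dots> = cip x x + of_real e * (cip y x + cnj (cip y x)) + of_real (e\<^sup>2) * cip y y"
      by (simp add: cip_add_left cip_add_right cip_smult_left cip_smult_right cip_cnj algebra_simps power2_eq_square)
    also have "\<dots> = complex_of_real ((norm x)\<^sup>2 + 2 * e * Re (cip y x) + e\<^sup>2 * (norm y)\<^sup>2)"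
      by (simp add: cip_self complex_add_cnj)
    finally show ?thesis by (simp only: of_real_eq_iff)
  qed
  have Kzg: "K *v (z + of_real e *s g) = K *v z + of_real e *s (K *v g)"
    by (simp add: matrix_vector_right_distrib vector_scalar_commute)
  have "cip (v i) (z + of_real e *s g) = 0" if "i \<in> S" for i
    using z(2)[OF that] gorth[OF that] by (simp add: cip_add_right cip_smult_right)
  then have bd: "(norm (K *v (z + of_real e *s g)))\<^sup>2 \<le> t\<^sup>2 * (norm (z + of_real e *s g))\<^sup>2"
    by (rule bound)
  have "t\<^sup>2 + 2 * e * Re (cip (K *v g) (K *v z)) + e\<^sup>2 * (norm (K *v g))\<^sup>2
      \<le> t\<^sup>2 * (1\<^sup>2 + 2 * e * Re (cip g z) + e\<^sup>2 * (norm g)\<^sup>2)"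
    using bd unfolding Kzg sq z(1) t_def[symmetric] .
  \<comment> \<open>By the choice of \<open>g\<close>, the first-order terms of the two sides differ
    by exactly \<open>2 * e * (norm g)\<^sup>2\<close>.\<close>
  moreover have "cip g g = cip (K *v g) (K *v z) - of_real (t\<^sup>2) * cip g z"
    by (subst (2) g_def) (simp add: cip_diff_right cip_smult_right cip_dagger)
  then have "Re (cip (K *v g) (K *v z)) = (norm g)\<^sup>2 + t\<^sup>2 * Re (cip g z)"
    by (simp add: cip_self complex_eq_iff)
  ultimately have "2 * e * (norm g)\<^sup>2 + e\<^sup>2 * (norm (K *v g))\<^sup>2 \<le> e\<^sup>2 * t\<^sup>2 * (norm g)\<^sup>2"
    by (simp add: distrib_left mult_ac)
  moreover have "0 \<le> e\<^sup>2 * (norm (K *v g))\<^sup>2"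
    by simp
  ultimately have "2 * e * (norm g)\<^sup>2 \<le> e\<^sup>2 * t\<^sup>2 * (norm g)\<^sup>2"
    by linarith
  then have "e * (2 * (norm g)\<^sup>2) \<le> e * (e * t\<^sup>2 * (norm g)\<^sup>2)"
    by (simp add: power2_eq_square mult_ac)
  then have "2 * (norm g)\<^sup>2 \<le> e * t\<^sup>2 * (norm g)\<^sup>2"
    using e by simp
  also have "\<dots> \<le> 1 * (norm g)\<^sup>2"
    using e by (intro mult_right_mono) auto
  finally have "g = 0" by simp
  then show ?thesis by (simp add: g_def t_def)
qed

text \<open>Induction on the index set, one singular triple at a time. The new right vector
  maximises \<open>norm (K *v x)\<close> over the unit vectors orthogonal to the earlier right
  vectors; the new left vector is its normalised image. Orthogonality to the earlier left vectors
  follows by moving \<open>K\<close> across the inner product.\<close>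

lemma singular_families:
  fixes K :: "'n::finite cmat" and S :: "'n set"
  assumes "finite S"
  shows "\<exists>u v m. \<forall>i\<in>S. 0 \<le> m i \<and> K *v v i = of_real (m i) *s u i \<and>
    dagger K *v u i = of_real (m i) *s v i \<and>
    (\<forall>j\<in>S. cip (u i) (u j) = (if i = j then 1 else 0) \<and> cip (v i) (v j) = (if i = j then 1 else 0))"
  using assms
proof induction
  case empty
  show ?case by simp
next
  case (insert k S)
  then obtain u v :: "'n \<Rightarrow> complex ^ 'n" and m :: "'n \<Rightarrow> real" where
    IH: "\<forall>i\<in>S. 0 \<le> m i \<and> K *v v i = of_real (m i) *s u i \<and>
    dagger K *v u i = of_real (m i) *s v i \<and>
    (\<forall>j\<in>S. cip (u i) (u j) = (if i = j then 1 else 0) \<and> cip (v i) (v j) = (if i = j then 1 else 0))"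
    by blast
  have m: "0 \<le> m i" and Kv: "K *v v i = of_real (m i) *s u i"
    and Ku: "dagger K *v u i = of_real (m i) *s v i" if "i \<in> S" for i
    using IH that by blast+
  have uu: "cip (u i) (u j) = (if i = j then 1 else 0)"
    and vv: "cip (v i) (v j) = (if i = j then 1 else 0)" if "i \<in> S" "j \<in> S" for i j
    using IH that by blast+
  define C where "C = {x. norm x = 1 \<and> (\<forall>i\<in>S. cip (v i) x = 0)}"
  have "C = sphere 0 1 \<inter> (\<Inter>i\<in>S. {x. cip (v i) x = 0})"
    by (auto simp: C_def)
  moreover have "closed (\<Inter>i\<in>S. {x. cip (v i) x = 0})"
    by (intro closed_INT ballI closed_Collect_eq continuous_intros)
  ultimately have "compact C"
    by (simp add: compact_Int_closed)
  moreover have "C \<noteq> {}"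
    using ex_unit_orthogonal[OF insert.hyps(2), of v] by (auto simp: C_def)
  moreover have "continuous_on C (\<lambda>x. norm (K *v x))"
    unfolding matrix_vector_mult_def by (intro continuous_intros)
  ultimately obtain z where "z \<in> C" and max: "\<And>x. x \<in> C \<Longrightarrow> norm (K *v x) \<le> norm (K *v z)"
    using continuous_attains_sup by metis
  then have z: "norm z = 1" "\<And>i. i \<in> S \<Longrightarrow> cip (v i) z = 0"
    by (auto simp: C_def)
  have uKz: "cip (u i) (K *v z) = 0" if "i \<in> S" for i
    using that z by (simp add: cip_mult_right Ku cip_smult_left)
  define t where "t = norm (K *v z)"
  have KKz: "dagger K *v (K *v z) = of_real (t\<^sup>2) *s z"
    unfolding t_def
  proof (rule maximiser_singular)
    show "cip (v i) (dagger K *v (K *v z)) = 0" if "i \<in> S" for i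
      using that by (simp add: cip_dagger Kv cip_smult_left uKz)
  qed (use z max in \<open>auto simp: C_def\<close>)
  obtain w where w: "norm w = 1" "\<And>i. i \<in> S \<Longrightarrow> cip (u i) w = 0"
    "K *v z = of_real t *s w" "dagger K *v w = of_real t *s z"
  proof (cases "t = 0")
    case False
    define w where "w = of_real (1 / t) *s (K *v z)"
    have "norm w = 1"
      unfolding w_def t_def by (rule norm_normalise) (use False in \<open>simp add: t_def\<close>)
    moreover have "K *v z = of_real t *s w"
      using False by (simp add: w_def vector_smult_assoc)
    moreover have "dagger K *v w = of_real t *s z"
    proof -
      have "dagger K *v w = of_real (1 / t) *s (of_real (t\<^sup>2) *s z)"
        unfolding w_def vector_scalar_commute KKz ..
      then show ?thesis
        using False by (simp add: vector_smult_assoc power2_eq_square)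
    qed
    moreover have "cip (u i) w = 0" if "i \<in> S" for i
      using uKz[OF that] by (simp add: w_def cip_smult_right)
    ultimately show ?thesis
      by (intro that) blast+
  next
    \<comment> \<open>A zero maximum yields no image to normalise, so any unit \<open>w\<close>
      orthogonal to the earlier left vectors is taken. Since \<open>dagger K *v w\<close> satisfies
      the constraints, maximality makes \<open>K\<close> vanish on it, and this forces it to be
      zero.\<close>
    case True
    obtain w where w: "norm w = 1" "\<And>i. i \<in> S \<Longrightarrow> cip (u i) w = 0"
      using ex_unit_orthogonal[OF insert.hyps(2), of u] by blast
    define g where "g = dagger K *v w"
    have g: "cip (v i) g = 0" if "i \<in> S" for i
      using that by (simp add: g_def cip_dagger Kv cip_smult_left w)
    have "K *v g = 0"
    proof (rule ccontr)
      assume *: "K *v g \<noteq> 0"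
      then have "g \<noteq> 0" by auto
      define y where "y = of_real (1 / norm g) *s g"
      have "norm y = 1"
        unfolding y_def by (rule norm_normalise) (rule \<open>g \<noteq> 0\<close>)
      then have "y \<in> C"
        by (simp add: C_def y_def cip_smult_right g)
      then have "norm (K *v y) \<le> t"
        unfolding t_def by (rule max)
      then have "of_real (1 / norm g) *s (K *v g) = 0"
        unfolding y_def vector_scalar_commute True by simp
      then show False
        using * \<open>g \<noteq> 0\<close> by simp
    qed
    then have "cip g g = 0"
      by (subst (2) g_def) (simp add: cip_dagger)
    then have "dagger K *v w = 0"
      by (simp add: g_def)
    moreover have "K *v z = 0"
      using True by (simp add: t_def)
    ultimately show ?thesis
      using w True by (intro that[of w]) auto
  qed
  have sym: "cip x y = 0" if "cip y x = 0" for x y :: "complex ^ 'n"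
    using that by (metis cip_cnj complex_cnj_zero)
  have cww: "cip w w = 1" and czz: "cip z z = 1"
    by (simp_all add: cip_self w(1) z(1))
  show ?case
  proof (rule exI[of _ "u(k := w)"], rule exI[of _ "v(k := z)"], rule exI[of _ "m(k := t)"], intro ballI conjI)
    fix i j
    assume i: "i \<in> insert k S"
    show "0 \<le> (m(k := t)) i" using i by (auto simp: m t_def)
    show "K *v (v(k := z)) i = of_real ((m(k := t)) i) *s (u(k := w)) i"
      using i by (auto simp: Kv w(3))
    show "dagger K *v (u(k := w)) i = of_real ((m(k := t)) i) *s (v(k := z)) i"
      using i by (auto simp: Ku w(4))
    assume j: "j \<in> insert k S"
    show "cip ((u(k := w)) i) ((u(k := w)) j) = (if i = j then 1 else 0)"
      using i j insert.hyps(2) by (auto simp: uu cww w(2) sym[OF w(2)])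
    show "cip ((v(k := z)) i) ((v(k := z)) j) = (if i = j then 1 else 0)"
      using i j insert.hyps(2) by (auto simp: vv czz z(2) sym[OF z(2)])
  qed
qed

definition diag_mat :: "('n::finite \<Rightarrow> complex) \<Rightarrow> 'n cmat" where
  "diag_mat m = (\<chi> i j. if i = j then m i else 0)"

lemma mult_diag_mat [simp]:
  "(A ** diag_mat m) $ i $ j = A $ i $ j * m j" "(diag_mat m ** A) $ i $ j = m i * A $ i $ j"
  by (simp_all add: diag_mat_def matrix_matrix_mult_def if_distrib if_distribR cong: if_cong)

text \<open>The families over all indices become the columns of \<open>U\<close> and
  \<open>V\<close>; for square matrices orthonormal columns give both unitarity equations. The last
  equation is the one that relates the left and right singular vectors of a Hermitian
  matrix.\<close>

lemma singular_value_decomposition: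
  fixes K :: "'n::finite cmat"
  obtains U V :: "'n cmat" and m :: "'n \<Rightarrow> real" where "dagger U ** U = mat 1" "U ** dagger U = mat 1"
    "dagger V ** V = mat 1" "V ** dagger V = mat 1" "\<And>i. 0 \<le> m i"
    "K = U ** diag_mat (\<lambda>i. of_real (m i)) ** dagger V"
    "dagger K ** U = V ** diag_mat (\<lambda>i. of_real (m i))"
proof -
  obtain u v :: "'n \<Rightarrow> complex ^ 'n" and m :: "'n \<Rightarrow> real" where
    *: "\<forall>i\<in>UNIV. 0 \<le> m i \<and> K *v v i = of_real (m i) *s u i \<and>
    dagger K *v u i = of_real (m i) *s v i \<and>
    (\<forall>j\<in>UNIV. cip (u i) (u j) = (if i = j then 1 else 0) \<and> cip (v i) (v j) = (if i = j then 1 else 0))"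
    using singular_families[OF finite[of UNIV], of K] by blast
  have m: "0 \<le> m i" and Kv: "K *v v i = of_real (m i) *s u i"
    and Ku: "dagger K *v u i = of_real (m i) *s v i" for i
    using * by blast+
  have uu: "cip (u i) (u j) = (if i = j then 1 else 0)"
    and vv: "cip (v i) (v j) = (if i = j then 1 else 0)" for i j
    using * by blast+
  define U :: "'n cmat" where "U = (\<chi> i j. u j $ i)"
  define V :: "'n cmat" where "V = (\<chi> i j. v j $ i)"
  have U: "dagger U ** U = mat 1"
    using uu by (simp add: vec_eq_iff U_def matrix_matrix_mult_def cip_def mat_def)
  then have U': "U ** dagger U = mat 1"
    by (rule matrix_left_right_inverse1)
  have V: "dagger V ** V = mat 1"
    using vv by (simp add: vec_eq_iff V_def matrix_matrix_mult_def cip_def mat_def)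
  have V': "V ** dagger V = mat 1"
    using V by (rule matrix_left_right_inverse1)
  have "K ** V = U ** diag_mat (\<lambda>i. of_real (m i))"
    using Kv by (simp add: vec_eq_iff) (simp add: matrix_matrix_mult_def matrix_vector_mult_def U_def V_def mult.commute)
  then have "K = U ** diag_mat (\<lambda>i. of_real (m i)) ** dagger V"
    by (metis V' matrix_mul_assoc matrix_mul_rid)
  moreover have "dagger K ** U = V ** diag_mat (\<lambda>i. of_real (m i))"
    using Ku by (simp add: vec_eq_iff) (simp add: matrix_matrix_mult_def matrix_vector_mult_def U_def V_def mult.commute)
  ultimately show ?thesis
    using that[of U V m] U U' V V' m by blast
qed

section \<open>Positive semidefinite matrices: spectral form, trace pairing, tensor products\<close>

lemma psd_cip: "psd A \<longleftrightarrow> (\<forall>v. cip v (A *v v) \<in> \<real>\<^sub>\<ge>\<^sub>0)"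
  by (simp add: psd_def cip_def)

text \<open>Polarisation: reality of the form at \<open>x + y\<close> and at
  \<open>x + \<i> *s y\<close> fixes both parts of the sesquilinear form.\<close>

lemma psd_hermitian:
  assumes "psd A"
  shows "dagger A = A"
proof -
  have *: "cip y (A *v x) = cnj (cip x (A *v y))" for x y
  proof -
    have Im0: "Im (cip w (A *v w)) = 0" for w
      using assms by (auto simp: psd_cip complex_nonneg_Reals_iff)
    have "Im (cip x (A *v y) + cip y (A *v x)) = 0"
      using Im0[of "x + y"] Im0[of x] Im0[of y]
      by (simp add: cip_add_left cip_add_right matrix_vector_right_distrib)
    moreover have "Im (\<i> * cip x (A *v y) - \<i> * cip y (A *v x)) = 0"
      using Im0[of "x + \<i> *s y"] Im0[of x] Im0[of y]
      by (simp add: cip_add_left cip_add_right cip_smult_left cip_smult_right matrix_vector_right_distrib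
          vector_scalar_commute)
    ultimately show ?thesis by (simp add: complex_eq_iff)
  qed
  have ax: "cip (axis i 1) (A *v axis j 1) = A $ i $ j" for i j
  proof -
    have "cip (axis i 1) (A *v axis j 1) = (\<Sum>k\<in>UNIV. if k = i then \<Sum>l\<in>UNIV. if l = j then A $ i $ j else 0 else 0)"
      unfolding cip_def matrix_vector_mult_def axis_def vec_lambda_beta
      by (intro sum.cong refl) (auto intro!: sum.cong simp del: sum.delta sum.delta')
    then show ?thesis by simp
  qed
  have "cnj (A $ j $ i) = A $ i $ j" for i j
    using *[of "axis j 1" "axis i 1"] unfolding ax by simp
  then show ?thesis
    by (simp only: vec_eq_iff dagger_nth) blast
qed

text \<open>The spectral theorem, read off from a singular value decomposition: a Hermitian
  \<open>A\<close> exchanges \<open>u i\<close> and \<open>v i\<close> up to the factor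
  \<open>m i\<close>. The entrywise form can be substituted directly into sums.\<close>

lemma psd_spectral:
  fixes A :: "'n::finite cmat"
  assumes "psd A"
  shows "\<exists>(c :: 'n \<Rightarrow> real) (v :: 'n \<Rightarrow> complex ^ 'n).
    (\<forall>m. 0 \<le> c m) \<and> (\<forall>i j. A $ i $ j = (\<Sum>m\<in>UNIV. of_real (c m) * (v m $ i * cnj (v m $ j))))"
proof -
  obtain U V :: "'n cmat" and m :: "'n \<Rightarrow> real" where UV: "dagger U ** U = mat 1" "U ** dagger U = mat 1"
    "dagger V ** V = mat 1" "V ** dagger V = mat 1" "\<And>i. 0 \<le> m i"
    "A = U ** diag_mat (\<lambda>i. of_real (m i)) ** dagger V"
    "dagger A ** U = V ** diag_mat (\<lambda>i. of_real (m i))"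
    by (rule singular_value_decomposition[of A], rule that)
  define u where "u i = (\<chi> k. U $ k $ i)" for i
  define v where "v i = (\<chi> k. V $ k $ i)" for i
  have Au: "A *v u i = of_real (m i) *s v i" for i
  proof -
    have "A ** U = V ** diag_mat (\<lambda>i. of_real (m i))"
      using UV(7) psd_hermitian[OF assms] by simp
    then have "(A ** U) $ k $ i = of_real (m i) * V $ k $ i" for k
      by (simp add: mult.commute)
    then show ?thesis
      by (simp add: vec_eq_iff u_def v_def matrix_matrix_mult_def matrix_vector_mult_def)
  qed
  have Av: "A *v v i = of_real (m i) *s u i" for i
  proof -
    have "A ** V = U ** diag_mat (\<lambda>i. of_real (m i))"
      by (subst UV(6)) (simp add: matrix_mul_assoc[symmetric] UV(3))
    then have "(A ** V) $ k $ i = of_real (m i) * U $ k $ i" for k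
      by (simp add: mult.commute)
    then show ?thesis
      by (simp add: vec_eq_iff u_def v_def matrix_matrix_mult_def matrix_vector_mult_def)
  qed
  \<comment> \<open>Since \<open>u i - v i\<close> is an eigenvector for \<open>- m i\<close>, the two singular vectors agree unless \<open>m i = 0\<close>.\<close>
  have uv: "of_real (m i) * u i $ k = of_real (m i) * v i $ k" for i k
  proof -
    have "A *v (u i - v i) = of_real (- m i) *s (u i - v i)"
      by (simp add: matrix_vector_mult_diff_distrib Au Av vec_eq_iff algebra_simps)
    then have "cip (u i - v i) (A *v (u i - v i)) = of_real (- m i * (norm (u i - v i))\<^sup>2)"
      by (simp only: cip_smult_right cip_self of_real_mult)
    moreover have "cip (u i - v i) (A *v (u i - v i)) \<in> \<real>\<^sub>\<ge>\<^sub>0"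
      using assms by (simp add: psd_cip)
    ultimately have "m i * (norm (u i - v i))\<^sup>2 \<le> 0"
      by (simp only: complex_nonneg_Reals_iff Re_complex_of_real) linarith
    then have "m i = 0 \<or> u i = v i"
      using UV(5)[of i] by (auto simp: mult_le_0_iff)
    then show ?thesis by auto
  qed
  have "A $ i $ j = (\<Sum>k\<in>UNIV. of_real (m k) * (v k $ i * cnj (v k $ j)))" for i j
  proof -
    have "A $ i $ j = (\<Sum>k\<in>UNIV. (of_real (m k) * u k $ i) * cnj (v k $ j))"
      by (subst UV(6), subst matrix_matrix_mult_def) (simp add: u_def v_def mult.commute)
    then show ?thesis by (simp add: uv mult.assoc)
  qed
  with UV(5) show ?thesis by blast
qed

lemma sum_nonneg_Reals:
  assumes "\<And>x. x \<in> S \<Longrightarrow> f x \<in> \<real>\<^sub>\<ge>\<^sub>0"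
  shows "sum f S \<in> \<real>\<^sub>\<ge>\<^sub>0"
  using assms by (induction S rule: infinite_finite_induct) auto

lemma cnj_mult_self_nonneg: "cnj w * w \<in> \<real>\<^sub>\<ge>\<^sub>0"
  by (simp add: complex_nonneg_Reals_iff)

lemma sum_UNIV_prod:
  fixes f :: "'a::finite \<times> 'b::finite \<Rightarrow> 'c::comm_monoid_add"
  shows "(\<Sum>p\<in>UNIV. f p) = (\<Sum>a\<in>UNIV. \<Sum>b\<in>UNIV. f (a, b))"
  by (simp add: sum.cartesian_product)

lemma cip_mult_vec: "cip x (A *v y) = (\<Sum>i\<in>UNIV. \<Sum>j\<in>UNIV. cnj (x $ i) * A $ i $ j * y $ j)"
  by (simp add: cip_def matrix_vector_mult_def sum_distrib_left mult.assoc)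

lemma trace_mult: "trace (A ** B) = (\<Sum>i\<in>UNIV. \<Sum>j\<in>UNIV. A $ i $ j * B $ j $ i)"
  by (simp add: trace_def matrix_matrix_mult_def)

lemma cip_sum_left: "cip (\<Sum>i\<in>S. f i) x = (\<Sum>i\<in>S. cip (f i) x)"
  and cip_sum_right: "cip x (\<Sum>i\<in>S. f i) = (\<Sum>i\<in>S. cip x (f i))"
  by (induction S rule: infinite_finite_induct) (auto simp: cip_add_left cip_add_right)

lemma mult_vec_sum: "A *v (\<Sum>i\<in>S. f i) = (\<Sum>i\<in>S. A *v f i)"
  by (induction S rule: infinite_finite_induct) (auto simp: matrix_vector_right_distrib)

text \<open>Expanding \<open>A\<close> into weighted dyads makes the trace a nonnegative combination
  of the values \<open>cip (v m) (B *v v m)\<close>.\<close>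

lemma psd_trace_mult:
  fixes A B :: "'n::finite cmat"
  assumes "psd A" "psd B"
  shows "trace (A ** B) \<in> \<real>\<^sub>\<ge>\<^sub>0"
proof -
  obtain c :: "'n \<Rightarrow> real" and v where
    *: "(\<forall>m. 0 \<le> c m) \<and> (\<forall>i j. A $ i $ j = (\<Sum>m\<in>UNIV. of_real (c m) * (v m $ i * cnj (v m $ j))))"
    using psd_spectral[OF assms(1)] by (elim exE)
  note cv = conjunct1[OF *, THEN spec] conjunct2[OF *, THEN spec, THEN spec]
  have "trace (A ** B) = (\<Sum>i\<in>UNIV. \<Sum>j\<in>UNIV. \<Sum>m\<in>UNIV. of_real (c m) * (v m $ i * cnj (v m $ j)) * B $ j $ i)"
    by (simp add: trace_mult cv(2) sum_distrib_right)
  also have "\<dots> = (\<Sum>i\<in>UNIV. \<Sum>m\<in>UNIV. \<Sum>j\<in>UNIV. of_real (c m) * (v m $ i * cnj (v m $ j)) * B $ j $ i)"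
    by (intro sum.cong refl sum.swap)
  also have "\<dots> = (\<Sum>m\<in>UNIV. \<Sum>i\<in>UNIV. \<Sum>j\<in>UNIV. of_real (c m) * (v m $ i * cnj (v m $ j)) * B $ j $ i)"
    by (rule sum.swap)
  also have "\<dots> = (\<Sum>m\<in>UNIV. of_real (c m) * cip (v m) (B *v v m))"
  proof (intro sum.cong refl)
    fix m
    show "(\<Sum>i\<in>UNIV. \<Sum>j\<in>UNIV. of_real (c m) * (v m $ i * cnj (v m $ j)) * B $ j $ i) =
        of_real (c m) * cip (v m) (B *v v m)"
      by (subst sum.swap) (simp add: cip_mult_vec sum_distrib_left mult_ac)
  qed
  finally show ?thesis
    using cv(1) assms(2)
    by (auto simp: psd_cip intro!: sum_nonneg_Reals nonneg_Reals_mult_I)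
qed

text \<open>Cut into slices \<open>w a\<close>, a test vector gives the value
  \<open>trace (A ** G)\<close>, where \<open>G\<close> is the Gram matrix of the slices with
  respect to \<open>B\<close> and hence positive semidefinite.\<close>

lemma psd_tensor_mat:
  fixes A :: "'n::finite cmat" and B :: "'m::finite cmat"
  assumes "psd A" "psd B"
  shows "psd (tensor_mat A B)"
  unfolding psd_cip
proof
  fix z :: "complex ^ ('n \<times> 'm)"
  define w where "w a = (\<chi> c. z $ (a, c))" for a
  define G :: "'n cmat" where "G = (\<chi> a b. cip (w b) (B *v w a))"
  have "psd G"
    unfolding psd_cip
  proof
    fix x :: "complex ^ 'n"
    let ?y = "\<Sum>a\<in>UNIV. cnj (x $ a) *s w a"
    have "cip x (G *v x) = (\<Sum>a\<in>UNIV. \<Sum>b\<in>UNIV. cnj (x $ a) * cip (w b) (B *v w a) * x $ b)"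
      by (simp add: cip_mult_vec G_def)
    also have "\<dots> = cip ?y (B *v ?y)"
      by (simp add: cip_sum_left cip_sum_right mult_vec_sum cip_smult_left cip_smult_right
          vector_scalar_commute mult_ac sum_distrib_left)
    finally show "cip x (G *v x) \<in> \<real>\<^sub>\<ge>\<^sub>0"
      using assms(2) by (simp add: psd_cip)
  qed
  have "cip z (tensor_mat A B *v z) =
      (\<Sum>a\<in>UNIV. \<Sum>c\<in>UNIV. \<Sum>b\<in>UNIV. \<Sum>e\<in>UNIV. cnj (z $ (a, c)) * (A $ a $ b * B $ c $ e) * z $ (b, e))"
    by (simp add: cip_mult_vec sum_UNIV_prod)
  also have "\<dots> = (\<Sum>a\<in>UNIV. \<Sum>b\<in>UNIV. \<Sum>c\<in>UNIV. \<Sum>e\<in>UNIV. cnj (z $ (a, c)) * (A $ a $ b * B $ c $ e) * z $ (b, e))"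
    by (intro sum.cong refl sum.swap)
  also have "\<dots> = trace (A ** G)"
    by (simp add: trace_mult G_def cip_mult_vec w_def sum_distrib_left mult_ac)
  also have "\<dots> \<in> \<real>\<^sub>\<ge>\<^sub>0"
    by (rule psd_trace_mult[OF assms(1) \<open>psd G\<close>])
  finally show "cip z (tensor_mat A B *v z) \<in> \<real>\<^sub>\<ge>\<^sub>0" .
qed

lemma psd_reindex:
  fixes f :: "'n::finite \<Rightarrow> 'm::finite"
  assumes "bij f" "psd A"
  shows "psd (\<chi> p q. A $ f p $ f q)"
  unfolding psd_cip
proof
  fix z :: "complex ^ 'n"
  define w where "w = (\<chi> p. z $ inv f p)"
  have w: "w $ f p = z $ p" for p
    using assms(1) by (simp add: w_def bij_is_inj)
  have "cip w (A *v w) = (\<Sum>i\<in>UNIV. \<Sum>j\<in>UNIV. cnj (w $ f i) * A $ f i $ f j * w $ f j)"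
    unfolding cip_mult_vec
    using sum.reindex_bij_betw[OF assms(1), of "\<lambda>i. \<Sum>j\<in>UNIV. cnj (w $ i) * A $ i $ j * w $ j"]
      sum.reindex_bij_betw[OF assms(1), of "\<lambda>j. cnj (w $ f i) * A $ f i $ j * w $ j" for i]
    by simp
  also have "\<dots> = cip z ((\<chi> p q. A $ f p $ f q) *v z)"
    by (simp add: cip_mult_vec w)
  finally show "cip z ((\<chi> p q. A $ f p $ f q) *v z) \<in> \<real>\<^sub>\<ge>\<^sub>0"
    using assms(2) by (metis psd_cip)
qed

lemma psd_add: "psd A \<Longrightarrow> psd B \<Longrightarrow> psd (A + B)"
  by (auto simp: psd_cip matrix_vector_mult_add_rdistrib cip_add_right)

lemma psd_scaleR:
  assumes "0 \<le> c" "psd A"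
  shows "psd (c *\<^sub>R A)"
proof -
  have "cip v (c *\<^sub>R A *v v) = of_real c * cip v (A *v v)" for v
    by (simp add: cip_mult_vec sum_distrib_left) (simp add: scaleR_conv_of_real mult_ac)
  then show ?thesis
    using assms by (simp add: psd_cip)
qed

text \<open>A certificate for positive multiples of orthogonal projections: \<open>A\<close> is
  \<open>dagger A ** A\<close> divided by \<open>c\<close>. All building blocks of the decomposition
  and of the witness are of this kind.\<close>

lemma psd_quasi_idempotent:
  assumes "dagger A = A" "A ** A = c *\<^sub>R A" "0 < c"
  shows "psd A"
proof -
  have "psd (A ** A)"
    unfolding psd_cip
  proof
    fix v
    have "cip v (A ** A *v v) = cip (A *v v) (A *v v)"
      by (simp add: matrix_vector_mul_assoc[symmetric] cip_mult_right assms(1))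
    then show "cip v (A ** A *v v) \<in> \<real>\<^sub>\<ge>\<^sub>0"
      by (simp add: cip_self)
  qed
  then have "psd ((1 / c) *\<^sub>R (A ** A))"
    using assms(3) by (intro psd_scaleR) auto
  then show ?thesis
    using assms by simp
qed

lemma psd_block_cip:
  "psd_block k B \<longleftrightarrow> (\<forall>v. (\<Sum>r<k. \<Sum>s<k. cip (v r) (B r s *v v s)) \<in> \<real>\<^sub>\<ge>\<^sub>0)"
  by (simp add: psd_block_def cip_def)

subsection \<open>Choi matrices\<close>

text \<open>The Kraus operators move onto the test vectors, so each summand is the block form of
  \<open>B\<close> at the vectors \<open>dagger (P h) *v v r\<close>. Separate weights
  \<open>c h\<close> match the spectral form and avoid square roots.\<close>

lemma completely_positive_kraus:
  fixes P :: "'k::finite \<Rightarrow> complex ^ 'n ^ 'm"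
  assumes "\<And>h. 0 \<le> c h" "complex_linear T"
    and T: "\<And>X k l. T X $ k $ l = (\<Sum>h\<in>UNIV. of_real (c h) * (P h ** X ** dagger (P h)) $ k $ l)"
  shows "completely_positive T"
  unfolding completely_positive_def
proof (intro conjI allI impI)
  fix k and B :: "nat \<Rightarrow> nat \<Rightarrow> 'n cmat"
  assume B: "psd_block k B"
  show "psd_block k (\<lambda>r s. T (B r s))"
    unfolding psd_block_cip
  proof
    fix v :: "nat \<Rightarrow> complex ^ 'm"
    have cipT: "cip x (T X *v y) = (\<Sum>h\<in>UNIV. of_real (c h) * cip (dagger (P h) *v x) (X *v (dagger (P h) *v y)))"
      for x y X
    proof -
      have "cip x (T X *v y) = (\<Sum>i\<in>UNIV. \<Sum>j\<in>UNIV. \<Sum>h\<in>UNIV.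
          of_real (c h) * (cnj (x $ i) * (P h ** X ** dagger (P h)) $ i $ j * y $ j))"
        by (simp add: cip_mult_vec T sum_distrib_left sum_distrib_right mult_ac)
      also have "\<dots> = (\<Sum>i\<in>UNIV. \<Sum>h\<in>UNIV. \<Sum>j\<in>UNIV.
          of_real (c h) * (cnj (x $ i) * (P h ** X ** dagger (P h)) $ i $ j * y $ j))"
        by (intro sum.cong refl sum.swap)
      also have "\<dots> = (\<Sum>h\<in>UNIV. of_real (c h) * cip x (P h ** X ** dagger (P h) *v y))"
        by (subst sum.swap) (simp only: cip_mult_vec sum_distrib_left)
      also have "\<dots> = (\<Sum>h\<in>UNIV. of_real (c h) * cip (dagger (P h) *v x) (X *v (dagger (P h) *v y)))"
        by (simp add: matrix_vector_mul_assoc[symmetric] cip_mult_right[of x "P _"])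
      finally show ?thesis .
    qed
    have "(\<Sum>r<k. \<Sum>s<k. cip (v r) (T (B r s) *v v s)) = (\<Sum>h\<in>UNIV. of_real (c h) *
        (\<Sum>r<k. \<Sum>s<k. cip (dagger (P h) *v v r) (B r s *v (dagger (P h) *v v s))))"
      unfolding cipT sum_distrib_left by (subst sum.swap, subst (2) sum.swap) (rule refl)
    also have "\<dots> \<in> \<real>\<^sub>\<ge>\<^sub>0"
    proof (rule sum_nonneg_Reals, rule nonneg_Reals_mult_I)
      show "complex_of_real (c h) \<in> \<real>\<^sub>\<ge>\<^sub>0" for h
        using assms(1) by simp
      show "(\<Sum>r<k. \<Sum>s<k. cip (dagger (P h) *v v r) (B r s *v (dagger (P h) *v v s))) \<in> \<real>\<^sub>\<ge>\<^sub>0" for h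
        using B unfolding psd_block_cip by (rule spec)
    qed
    finally show "(\<Sum>r<k. \<Sum>s<k. cip (v r) (T (B r s) *v v s)) \<in> \<real>\<^sub>\<ge>\<^sub>0" .
  qed
qed (rule assms(2))

lemma complex_linear_choi:
  assumes "complex_linear T"
  shows "T X $ k $ l = (\<Sum>i\<in>UNIV. \<Sum>j\<in>UNIV. X $ i $ j * choi T $ (i, k) $ (j, l))"
  by (subst complex_linear_expansion[OF assms, of X]) (simp add: choi_nth)

text \<open>One half of Choi's theorem: eigenvectors of the Choi matrix, reshaped into matrices, are
  Kraus operators.\<close>

lemma completely_positive_if_psd_choi:
  fixes T :: "'n::finite cmat \<Rightarrow> 'n cmat"
  assumes "complex_linear T" "psd (choi T)"
  shows "completely_positive T"
proof -
  obtain c and v :: "'n \<times> 'n \<Rightarrow> complex ^ ('n \<times> 'n)" where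
    *: "(\<forall>m. 0 \<le> c m) \<and> (\<forall>p q. choi T $ p $ q = (\<Sum>m\<in>UNIV. of_real (c m) * (v m $ p * cnj (v m $ q))))"
    using psd_spectral[OF assms(2)] by (elim exE)
  note cv = conjunct1[OF *, THEN spec] conjunct2[OF *, THEN spec, THEN spec]
  \<comment> \<open>The first component of a Choi index is the input, so it becomes the column index
    of the Kraus operator.\<close>
  define P :: "'n \<times> 'n \<Rightarrow> 'n cmat" where "P h = (\<chi> k i. v h $ (i, k))" for h
  show ?thesis
  proof (rule completely_positive_kraus[OF cv(1) assms(1)])
    fix X k l
    have "T X $ k $ l = (\<Sum>i\<in>UNIV. \<Sum>j\<in>UNIV. \<Sum>h\<in>UNIV. of_real (c h) * (v h $ (i, k) * X $ i $ j * cnj (v h $ (j, l))))"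
      by (simp add: complex_linear_choi[OF assms(1)] cv(2) sum_distrib_left mult_ac)
    also have "\<dots> = (\<Sum>i\<in>UNIV. \<Sum>h\<in>UNIV. \<Sum>j\<in>UNIV. of_real (c h) * (v h $ (i, k) * X $ i $ j * cnj (v h $ (j, l))))"
      by (intro sum.cong refl sum.swap)
    also have "\<dots> = (\<Sum>h\<in>UNIV. \<Sum>i\<in>UNIV. \<Sum>j\<in>UNIV. of_real (c h) * (v h $ (i, k) * X $ i $ j * cnj (v h $ (j, l))))"
      by (rule sum.swap)
    also have "\<dots> = (\<Sum>h\<in>UNIV. \<Sum>j\<in>UNIV. \<Sum>i\<in>UNIV. of_real (c h) * (v h $ (i, k) * X $ i $ j * cnj (v h $ (j, l))))"
      by (intro sum.cong refl sum.swap)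
    also have "\<dots> = (\<Sum>h\<in>UNIV. of_real (c h) * (P h ** X ** dagger (P h)) $ k $ l)"
      by (simp add: matrix_matrix_mult_def P_def sum_distrib_left sum_distrib_right)
    finally show "T X $ k $ l = (\<Sum>h\<in>UNIV. of_real (c h) * (P h ** X ** dagger (P h)) $ k $ l)" .
  qed
qed

text \<open>The other half: the matrix units, arranged as \<open>CARD('n)\<close> times
  \<open>CARD('n)\<close> blocks, form a positive semidefinite block matrix, and complete positivity
  is applied to it. The enumeration \<open>f\<close> translates numbered blocks into basis
  indices.\<close>

lemma psd_choi_if_completely_positive:
  fixes T :: "'n::finite cmat \<Rightarrow> 'n cmat"
  assumes "completely_positive T"
  shows "psd (choi T)"
  unfolding psd_cip
proof
  fix z :: "complex ^ ('n \<times> 'n)"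
  obtain f :: "nat \<Rightarrow> 'n" where f: "bij_betw f {..<CARD('n)} UNIV"
    using ex_bij_betw_nat_finite[of "UNIV :: 'n set"] by (auto simp: atLeast0LessThan)
  have re: "(\<Sum>r<CARD('n). g (f r)) = (\<Sum>i\<in>UNIV. g i)" for g :: "'n \<Rightarrow> complex"
    by (rule sum.reindex_bij_betw[OF f])
  have "psd_block CARD('n) (\<lambda>r s. matrix_unit (f r) (f s))"
    unfolding psd_block_cip
  proof
    fix v :: "nat \<Rightarrow> complex ^ 'n"
    have "cip x (matrix_unit a b *v y) = cnj (x $ a) * y $ b" for x y :: "complex ^ 'n" and a b
    proof -
      have "cip x (matrix_unit a b *v y) = (\<Sum>i\<in>UNIV. if i = a then \<Sum>j\<in>UNIV. if j = b then cnj (x $ a) * y $ b else 0 else 0)"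
        unfolding cip_mult_vec matrix_unit_nth
        by (intro sum.cong refl) (auto intro!: sum.cong simp del: sum.delta sum.delta')
      then show ?thesis by simp
    qed
    then have "(\<Sum>r<CARD('n). \<Sum>s<CARD('n). cip (v r) (matrix_unit (f r) (f s) *v v s)) =
        cnj (\<Sum>r<CARD('n). v r $ f r) * (\<Sum>r<CARD('n). v r $ f r)"
      by (simp add: sum_product)
    also have "\<dots> \<in> \<real>\<^sub>\<ge>\<^sub>0"
      by (rule cnj_mult_self_nonneg)
    finally show "(\<Sum>r<CARD('n). \<Sum>s<CARD('n). cip (v r) (matrix_unit (f r) (f s) *v v s)) \<in> \<real>\<^sub>\<ge>\<^sub>0" .
  qed
  then have Tblock: "psd_block CARD('n) (\<lambda>r s. T (matrix_unit (f r) (f s)))"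
    using assms by (auto simp: completely_positive_def)
  define F where "F i j = cip (\<chi> k. z $ (i, k)) (T (matrix_unit i j) *v (\<chi> k. z $ (j, k)))" for i j
  from Tblock have "(\<Sum>r<CARD('n). \<Sum>s<CARD('n). cip (\<chi> k. z $ (f r, k)) (T (matrix_unit (f r) (f s)) *v (\<chi> k. z $ (f s, k)))) \<in> \<real>\<^sub>\<ge>\<^sub>0"
    by (auto simp: psd_block_cip)
  also have "(\<Sum>r<CARD('n). \<Sum>s<CARD('n). cip (\<chi> k. z $ (f r, k)) (T (matrix_unit (f r) (f s)) *v (\<chi> k. z $ (f s, k)))) =
      (\<Sum>i\<in>UNIV. \<Sum>j\<in>UNIV. F i j)"
    using re[of "\<lambda>i. \<Sum>j\<in>UNIV. F i j"] re[of "F i" for i] by (simp add: F_def)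
  also have "\<dots> = (\<Sum>i\<in>UNIV. \<Sum>j\<in>UNIV. \<Sum>k\<in>UNIV. \<Sum>l\<in>UNIV. cnj (z $ (i, k)) * choi T $ (i, k) $ (j, l) * z $ (j, l))"
    by (simp add: F_def cip_mult_vec choi_nth)
  also have "\<dots> = (\<Sum>i\<in>UNIV. \<Sum>k\<in>UNIV. \<Sum>j\<in>UNIV. \<Sum>l\<in>UNIV. cnj (z $ (i, k)) * choi T $ (i, k) $ (j, l) * z $ (j, l))"
    by (intro sum.cong refl sum.swap)
  also have "\<dots> = cip z (choi T *v z)"
    by (simp add: cip_mult_vec sum_UNIV_prod)
  finally show "cip z (choi T *v z) \<in> \<real>\<^sub>\<ge>\<^sub>0" .
qed

section \<open>Partial transposition and the Choi form of decomposability\<close>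

definition partial_transpose :: "('n::finite \<times> 'm::finite) cmat \<Rightarrow> ('n \<times> 'm) cmat" where
  "partial_transpose M = (\<chi> p q. M $ (fst p, snd q) $ (fst q, snd p))"

lemma partial_transpose_nth [simp]: "partial_transpose M $ (i, k) $ (j, l) = M $ (i, l) $ (j, k)"
  by (simp add: partial_transpose_def)

text \<open>Self-adjointness for the trace pairing; it carries the partial transposition from
  \<open>Q\<close> over to a dual witness.\<close>

lemma trace_partial_transpose_mult: "trace (partial_transpose M ** N) = trace (M ** partial_transpose N)"
proof -
  have "trace (partial_transpose M ** N) =
      (\<Sum>i\<in>UNIV. \<Sum>k\<in>UNIV. \<Sum>j\<in>UNIV. \<Sum>l\<in>UNIV. M $ (i, l) $ (j, k) * N $ (j, l) $ (i, k))"
    by (simp add: trace_mult sum_UNIV_prod)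
  also have "\<dots> = (\<Sum>i\<in>UNIV. \<Sum>j\<in>UNIV. \<Sum>k\<in>UNIV. \<Sum>l\<in>UNIV. M $ (i, l) $ (j, k) * N $ (j, l) $ (i, k))"
    by (intro sum.cong refl sum.swap)
  also have "\<dots> = (\<Sum>i\<in>UNIV. \<Sum>j\<in>UNIV. \<Sum>l\<in>UNIV. \<Sum>k\<in>UNIV. M $ (i, l) $ (j, k) * N $ (j, l) $ (i, k))"
    by (intro sum.cong refl sum.swap)
  also have "\<dots> = (\<Sum>i\<in>UNIV. \<Sum>l\<in>UNIV. \<Sum>j\<in>UNIV. \<Sum>k\<in>UNIV. M $ (i, l) $ (j, k) * N $ (j, l) $ (i, k))"
    by (intro sum.cong refl sum.swap)
  also have "\<dots> = trace (M ** partial_transpose N)"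
    by (simp add: trace_mult sum_UNIV_prod)
  finally show ?thesis .
qed

lemma choi_transpose: "choi (\<lambda>X. transpose (T X)) = partial_transpose (choi T)"
  by (simp add: vec_eq_iff choi_nth transpose_def)

lemma choi_add: "choi (\<lambda>X. S X + T X) = choi S + choi T"
  by (simp add: vec_eq_iff choi_nth)

lemma complex_linear_transpose: "complex_linear T \<Longrightarrow> complex_linear (\<lambda>X. transpose (T X))"
  by (simp add: complex_linear_iff vec_eq_iff transpose_def)

lemma complex_linear_add: "complex_linear S \<Longrightarrow> complex_linear T \<Longrightarrow> complex_linear (\<lambda>X. S X + T X)"
  by (simp add: complex_linear_iff vec_eq_iff algebra_simps)

text \<open>Linear maps and Choi matrices correspond bijectively. Complete positivity becomes
  positive semidefiniteness, and transposing the output becomes partial transposition.\<close>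

lemma decomposable_iff_choi:
  fixes L :: "'n::finite cmat \<Rightarrow> 'n cmat"
  assumes "complex_linear L"
  shows "decomposable L \<longleftrightarrow> (\<exists>P Q. psd P \<and> psd Q \<and> choi L = P + partial_transpose Q)"
proof
  assume "decomposable L"
  then obtain S T where "completely_positive S" "completely_positive T"
    and L: "L = (\<lambda>X. S X + transpose (T X))"
    unfolding decomposable_def by blast
  then have "psd (choi S)" "psd (choi T)"
    by (auto intro: psd_choi_if_completely_positive)
  moreover have "choi L = choi S + partial_transpose (choi T)"
    unfolding L choi_add choi_transpose ..
  ultimately show "\<exists>P Q. psd P \<and> psd Q \<and> choi L = P + partial_transpose Q"
    by blast
next
  assume "\<exists>P Q. psd P \<and> psd Q \<and> choi L = P + partial_transpose Q"
  then obtain P Q where PQ: "psd P" "psd Q" "choi L = P + partial_transpose Q"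
    by blast
  obtain S where S: "complex_linear S" "choi S = P"
    using ex1_choi[of P] by blast
  obtain T where T: "complex_linear T" "choi T = Q"
    using ex1_choi[of Q] by blast
  have "choi (\<lambda>X. S X + transpose (T X)) = choi L"
    by (simp add: choi_add choi_transpose S T PQ)
  then have "L = (\<lambda>X. S X + transpose (T X))"
    using ex1_choi[of "choi L"] assms complex_linear_add[OF S(1) complex_linear_transpose[OF T(1)]]
    by blast
  moreover have "completely_positive S" "completely_positive T"
    using S T PQ by (auto intro: completely_positive_if_psd_choi)
  ultimately show "decomposable L"
    unfolding decomposable_def by blast
qed

section \<open>Choi matrix of a tensor product of maps\<close>

definition swap_middle :: "('a \<times> 'b) \<times> ('c \<times> 'd) \<Rightarrow> ('a \<times> 'c) \<times> ('b \<times> 'd)" where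
  "swap_middle p = ((fst (fst p), fst (snd p)), (snd (fst p), snd (snd p)))"

lemma swap_middle_simp [simp]: "swap_middle ((a, b), (c, d)) = ((a, c), (b, d))"
  by (simp add: swap_middle_def)

lemma bij_swap_middle: "bij swap_middle"
  by (rule o_bij[of swap_middle]) (auto simp: fun_eq_iff)

text \<open>A tensor product of Choi matrices groups the indices by tensor factor, while the Choi
  matrix of a tensor product map puts all inputs before all outputs. Exchanging the two middle
  indices translates between them.\<close>

definition shuffle :: "('n::finite \<times> 'n) cmat \<Rightarrow> ('m::finite \<times> 'm) cmat \<Rightarrow> (('n \<times> 'm) \<times> ('n \<times> 'm)) cmat" where
  "shuffle A B = (\<chi> p q. tensor_mat A B $ swap_middle p $ swap_middle q)"

lemma shuffle_nth [simp]:
  "shuffle A B $ ((a, c), (k, m)) $ ((b, e), (l, n)) = A $ (a, k) $ (b, l) * B $ (c, m) $ (e, n)"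
  by (simp add: shuffle_def)

lemma psd_shuffle: "psd A \<Longrightarrow> psd B \<Longrightarrow> psd (shuffle A B)"
  unfolding shuffle_def by (intro psd_reindex bij_swap_middle psd_tensor_mat)

lemma partial_transpose_shuffle:
  "partial_transpose (shuffle A B) = shuffle (partial_transpose A) (partial_transpose B)"
  by (simp add: vec_eq_iff)

lemma trace_shuffle_mult:
  fixes A C :: "('n::finite \<times> 'n) cmat" and B D :: "('m::finite \<times> 'm) cmat"
  shows "trace (shuffle A B ** shuffle C D) = trace (A ** C) * trace (B ** D)"
proof -
  let ?T = "\<lambda>p q. tensor_mat A B $ p $ q * tensor_mat C D $ q $ p"
  have "trace (shuffle A B ** shuffle C D) = (\<Sum>p\<in>UNIV. \<Sum>q\<in>UNIV. ?T (swap_middle p) (swap_middle q))"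
    by (simp add: trace_mult shuffle_def)
  also have "\<dots> = (\<Sum>p\<in>UNIV. \<Sum>q\<in>UNIV. ?T p q)"
    using sum.reindex_bij_betw[OF bij_swap_middle, of "\<lambda>p. \<Sum>q\<in>UNIV. ?T p q"]
      sum.reindex_bij_betw[OF bij_swap_middle, of "?T p" for p] by simp
  also have "\<dots> = (\<Sum>a\<in>UNIV. \<Sum>c\<in>UNIV. \<Sum>b\<in>UNIV. \<Sum>e\<in>UNIV. (A $ a $ b * C $ b $ a) * (B $ c $ e * D $ e $ c))"
    by (simp add: sum_UNIV_prod[where 'a = "'n \<times> 'n" and 'b = "'m \<times> 'm"] mult_ac)
  also have "\<dots> = trace (A ** C) * trace (B ** D)"
    by (simp only: trace_mult sum_product)
  finally show ?thesis .
qed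

lemma choi_tensor_map:
  assumes "complex_linear L" "complex_linear M"
  shows "choi (tensor_map L M) = shuffle (choi L) (choi M)"
proof -
  have unit: "matrix_unit (a, c) (b, e) = tensor_mat (matrix_unit a b) (matrix_unit c e)" for a b c e
    by (auto simp: vec_eq_iff)
  show ?thesis
    by (simp add: vec_eq_iff choi_nth unit tensor_map_tensor_mat[OF assms])
qed

subsection \<open>The flip and the maximally entangled operator\<close>

text \<open>The matrix \<open>omega\<close> in closed form: an unnormalised projection onto a
  maximally entangled vector.\<close>

definition max_ent :: "('n::finite \<times> 'n) cmat" where
  "max_ent = (\<chi> p q. if fst p = snd p \<and> fst q = snd q then 1 else 0)"

lemma max_ent_nth [simp]: "max_ent $ (i, k) $ (j, l) = (if i = k \<and> j = l then 1 else 0)"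
  by (simp add: max_ent_def)

lemma flip_mat_nth [simp]: "flip_mat $ (i, k) $ (j, l) = (if i = l \<and> k = j then 1 else 0)"
  by (simp add: flip_mat_def)

lemma mat_prod_nth [simp]: "mat 1 $ (i, k) $ (j, l) = (if i = j \<and> k = l then 1 else 0)"
  by (simp add: mat_def)

lemma partial_transpose_add: "partial_transpose (A + B) = partial_transpose A + partial_transpose B"
  and partial_transpose_diff: "partial_transpose (A - B) = partial_transpose A - partial_transpose B"
  and partial_transpose_scaleR: "partial_transpose (c *\<^sub>R A) = c *\<^sub>R partial_transpose A"
  by (simp_all add: vec_eq_iff)

lemma partial_transpose_flip: "partial_transpose flip_mat = max_ent"
  and partial_transpose_max_ent: "partial_transpose max_ent = flip_mat"
  and partial_transpose_mat: "partial_transpose (mat 1) = mat 1"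
  by (auto simp: vec_eq_iff)

lemma flip_mult_flip: "flip_mat ** flip_mat = (mat 1 :: ('n::finite \<times> 'n) cmat)"
proof -
  have "(flip_mat ** flip_mat) $ (i, k) $ (j, l) = (mat 1 :: ('n \<times> 'n) cmat) $ (i, k) $ (j, l)" for i j k l :: 'n
  proof -
    have "(flip_mat ** flip_mat) $ (i, k) $ (j, l) =
        (\<Sum>a\<in>UNIV. if a = k then \<Sum>b\<in>UNIV. if b = i then if i = j \<and> k = l then 1 else 0 else 0 else 0 :: complex)"
      unfolding matrix_matrix_mult_def vec_lambda_beta sum_UNIV_prod
      by (intro sum.cong refl) (auto intro!: sum.cong sum.neutral simp del: sum.delta sum.delta')
    then show ?thesis by simp
  qed
  then show ?thesis by (simp add: vec_eq_iff del: flip_mat_nth mat_prod_nth)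
qed

lemma max_ent_mult_max_ent: "max_ent ** max_ent = real CARD('n) *\<^sub>R (max_ent :: ('n::finite \<times> 'n) cmat)"
proof -
  have "(max_ent ** max_ent) $ (i, k) $ (j, l) = (real CARD('n) *\<^sub>R (max_ent :: ('n \<times> 'n) cmat)) $ (i, k) $ (j, l)" for i j k l :: 'n
  proof -
    have "(max_ent ** max_ent) $ (i, k) $ (j, l) =
        (\<Sum>a\<in>UNIV. \<Sum>b\<in>(UNIV :: 'n set). if b = a then if i = k \<and> j = l then 1 else 0 else 0 :: complex)"
      unfolding matrix_matrix_mult_def vec_lambda_beta sum_UNIV_prod
      by (intro sum.cong refl) (auto simp del: sum.delta sum.delta')
    then show ?thesis
      unfolding vector_scaleR_component by (simp add: scaleR_conv_of_real)
  qed
  then show ?thesis by (simp add: vec_eq_iff del: max_ent_nth)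
qed

lemma trace_flip: "trace (flip_mat :: ('n::finite \<times> 'n) cmat) = of_nat CARD('n)"
proof -
  have "trace (flip_mat :: ('n::finite \<times> 'n) cmat) = (\<Sum>a\<in>UNIV. \<Sum>b\<in>(UNIV :: 'n set). if b = a then 1 else 0)"
    unfolding trace_def sum_UNIV_prod by (intro sum.cong refl) auto
  then show ?thesis by simp
qed

lemma trace_max_ent: "trace (max_ent :: ('n::finite \<times> 'n) cmat) = of_nat CARD('n)"
proof -
  have "trace (max_ent :: ('n::finite \<times> 'n) cmat) = (\<Sum>a\<in>UNIV. \<Sum>b\<in>(UNIV :: 'n set). if b = a then 1 else 0)"
    unfolding trace_def sum_UNIV_prod by (intro sum.cong refl) auto
  then show ?thesis by simp
qed

lemma dagger_add: "dagger (A + B) = dagger A + dagger B"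
  and dagger_diff: "dagger (A - B) = dagger A - dagger B"
  and dagger_scaleR: "dagger (c *\<^sub>R A) = c *\<^sub>R dagger A"
  by (simp_all add: vec_eq_iff)

lemma dagger_flip: "dagger flip_mat = flip_mat"
  and dagger_max_ent: "dagger max_ent = max_ent"
  and dagger_mat_1: "dagger (mat 1) = mat 1"
  by (auto simp: vec_eq_iff mat_def)

lemma scaleR_mult_mat: "(c *\<^sub>R A) ** B = c *\<^sub>R (A ** (B :: 'n::finite cmat))"
  and mult_scaleR_mat: "A ** (c *\<^sub>R B) = c *\<^sub>R (A ** (B :: 'n::finite cmat))"
  and mult_add_mat: "(A + B) ** C = A ** C + B ** (C :: 'n::finite cmat)"
  and mult_diff_mat: "(A - B) ** C = A ** C - B ** (C :: 'n::finite cmat)"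
  and mult_mat_diff: "C ** (A - B) = C ** A - C ** (B :: 'n::finite cmat)"
  by (simp_all add: vec_eq_iff matrix_matrix_mult_def scaleR_sum_right sum.distrib sum_subtractf algebra_simps)

lemma trace_scaleR: "trace (c *\<^sub>R A) = of_real c * trace (A :: 'n::finite cmat)"
  by (simp add: trace_def sum_distrib_left) (simp add: scaleR_conv_of_real)

lemmas mat_mult_simps = matrix_add_ldistrib mult_add_mat mult_diff_mat mult_mat_diff
  scaleR_mult_mat mult_scaleR_mat flip_mult_flip max_ent_mult_max_ent

lemma psd_max_ent: "psd (max_ent :: ('n::finite \<times> 'n) cmat)"
  by (rule psd_quasi_idempotent[OF dagger_max_ent max_ent_mult_max_ent]) simp

lemma psd_flip: "psd (mat 1 + flip_mat :: ('n::finite \<times> 'n) cmat)" "psd (mat 1 - flip_mat :: ('n::finite \<times> 'n) cmat)"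
proof -
  show "psd (mat 1 + flip_mat :: ('n::finite \<times> 'n) cmat)"
    by (rule psd_quasi_idempotent[of _ 2])
       (simp_all add: dagger_add dagger_mat_1 dagger_flip mat_mult_simps scaleR_2)
  show "psd (mat 1 - flip_mat :: ('n::finite \<times> 'n) cmat)"
    by (rule psd_quasi_idempotent[of _ 2])
       (simp_all add: dagger_diff dagger_mat_1 dagger_flip mat_mult_simps scaleR_2)
qed

lemma psd_max_ent_complement: "psd (real CARD('n) *\<^sub>R mat 1 - max_ent :: ('n::finite \<times> 'n) cmat)"
  by (rule psd_quasi_idempotent[of _ "real CARD('n)"])
     (simp_all add: dagger_diff dagger_scaleR dagger_mat_1 dagger_max_ent mat_mult_simps algebra_simps)

subsection \<open>Decomposability\<close>

text \<open>
  Here \<open>s\<close> and \<open>r\<close> are the eigenvalues of \<open>a \<cdot> 1 + b F\<close> on the symmetric and the antisymmetric subspace.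
  The coefficients \<open>r2\<close> and \<open>r3\<close> of \<open>Q\<close> are those for which \<open>P\<close> vanishes on the symmetric subspace of
  the first factor; \<open>h0\<close> and \<open>hd\<close> are the eigenvalues of \<open>P\<close> that remain.
\<close>

lemma shuffle_werner_decomposition:
  fixes s r :: real
  defines "d \<equiv> real CARD('n::finite)"
  defines "a \<equiv> (s + r) / 2" and "b \<equiv> (s - r) / 2"
  assumes d2: "d \<ge> 2" and s0: "s \<ge> 0" and r0: "r \<ge> 0" and crit: "r * (a + b * d) + (d + 1) * s * a \<ge> 0"
  shows "\<exists>P Q. psd P \<and> psd Q \<and>
    shuffle (a *\<^sub>R mat 1 + b *\<^sub>R flip_mat :: ('n \<times> 'n) cmat) (a *\<^sub>R mat 1 + b *\<^sub>R max_ent :: ('n \<times> 'n) cmat) = P + partial_transpose Q"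
proof -
  define h0 where "h0 = (r\<^sup>2 + s\<^sup>2 - 2 * s * r / (d - 1)) / 2"
  define hd where "hd = r * (a + b * d) + (d + 1) * s * a"
  \<comment> \<open>With the flip replaced by 1, the equation to be solved is
    \<open>s * (a + b * w) = r2 * (d - 1) * (1 - w) + r3 * (1 + w)\<close>; comparing coefficients
    gives \<open>r2\<close> and \<open>r3\<close>.\<close>
  define r2 where "r2 = s * r / (d - 1) / 2"
  define r3 where "r3 = s\<^sup>2 / 2"
  let ?I = "mat 1 :: ('n \<times> 'n) cmat"
  let ?F = "flip_mat :: ('n \<times> 'n) cmat"
  let ?w = "max_ent :: ('n \<times> 'n) cmat"
  \<comment> \<open>\<open>mat 1 - flip_mat\<close> has eigenvalue 2, and both
    \<open>max_ent\<close> and its complement have eigenvalue \<open>d\<close>. The divisor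
    \<open>2 * d\<close> thus makes \<open>h0\<close> and \<open>hd\<close> the eigenvalues of
    \<open>P\<close>, and \<open>crit\<close> says that \<open>hd\<close> is nonnegative.\<close>
  define P where "P = shuffle (?I - ?F) ((h0 / (2 * d)) *\<^sub>R (d *\<^sub>R ?I - ?w) + (hd / (2 * d)) *\<^sub>R ?w)"
  define Q where "Q = r2 *\<^sub>R shuffle (d *\<^sub>R ?I - ?w) (?I - ?F) + r3 *\<^sub>R shuffle ?w (?I + ?F)"
  have "s * r / (d - 1) \<le> s * r"
    using mult_nonneg_nonneg[OF s0 r0] d2 by (simp add: divide_le_eq mult_le_cancel_left1)
  moreover have "2 * (s * r) \<le> r\<^sup>2 + s\<^sup>2"
    using sum_squares_bound[of s r] by simp
  ultimately have "h0 \<ge> 0"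
    by (simp add: h0_def)
  have "psd P"
    unfolding P_def using assms \<open>h0 \<ge> 0\<close> crit psd_max_ent_complement[where 'n = 'n]
    by (intro psd_shuffle psd_flip psd_add psd_scaleR psd_max_ent) (auto simp: hd_def)
  moreover have "psd Q"
    unfolding Q_def using assms psd_max_ent_complement[where 'n = 'n]
    by (intro psd_shuffle psd_flip psd_add psd_scaleR psd_max_ent) (auto simp: r2_def r3_def)
  moreover have "shuffle (a *\<^sub>R ?I + b *\<^sub>R ?F) (a *\<^sub>R ?I + b *\<^sub>R ?w) = P + partial_transpose Q"
  proof -
    have d: "d - 1 > 0" "d > 0"
      using assms by auto
    have e: "s * r = r2 * (2 * (d - 1))"
      using d by (simp add: r2_def field_simps)
    have h0: "h0 = (r\<^sup>2 + s\<^sup>2) / 2 - 2 * r2"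
      using d by (simp add: h0_def r2_def field_simps)
    define H K where "H = h0 / (2 * d)" and "K = hd / (2 * d)"
    \<comment> \<open>\<open>c1\<close> to \<open>c4\<close> compare the coefficients of the four
      products of the identity or the flip with the identity or \<open>max_ent\<close>.\<close>
    have c1: "a * a = H * d + r2 * d"
    proof -
      have "a * a = (r\<^sup>2 + s\<^sup>2) / 4 + s * r / 2"
        by (simp add: a_def field_simps power2_eq_square)
      also have "\<dots> = (r\<^sup>2 + s\<^sup>2) / 4 + r2 * (d - 1)"
        using e by simp
      also have "\<dots> = h0 / 2 + r2 * d"
        by (simp add: h0 field_simps)
      finally show ?thesis
        using d by (simp add: H_def)
    qed
    have c3: "a * b = - H * d - r2 + r3"
      using d by (simp add: H_def h0 a_def b_def r3_def field_simps power2_eq_square)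
    have c2: "a * b = K - H - r2 * d"
    proof -
      have "hd - h0 = 2 * d * (a * b) + (d + 1) * (s * r) + 2 * r2"
        by (simp add: hd_def h0 a_def b_def field_simps power2_eq_square)
      also have "\<dots> = 2 * d * (a * b + r2 * d)"
        unfolding e by (simp add: field_simps)
      finally have "(hd - h0) / (2 * d) = a * b + r2 * d"
        using d by simp
      then show ?thesis
        by (simp add: H_def K_def diff_divide_distrib)
    qed
    have c4: "b * b = H - K + r2 + r3"
    proof -
      have "b * b = a * a - s * r"
        by (simp add: a_def b_def field_simps)
      also have "\<dots> = H * d + r2 * d - r2 * (2 * (d - 1))"
        by (simp only: c1 e)
      also have "H * d = r3 - r2 - a * b"
        by (simp add: c3)
      finally show ?thesis
        unfolding c2 by (simp add: algebra_simps)
    qed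
    \<comment> \<open>Entries of \<open>shuffle\<close> are products of entries, so the matrix
      equation reduces to this identity for arbitrary complex numbers.\<close>
    have key: "(of_real a * o1 + of_real b * f) * (of_real a * o2 + of_real b * w) =
        (o1 - f) * (of_real H * (of_real d * o2 - w) + of_real K * w) +
        (of_real r2 * ((of_real d * o1 - f) * (o2 - w)) + of_real r3 * (f * (o2 + w)))"
      for o1 f o2 w :: complex
    proof -
      have "(of_real a * o1 + of_real b * f) * (of_real a * o2 + of_real b * w) =
          of_real (a * a) * (o1 * o2) + of_real (a * b) * (o1 * w) + of_real (a * b) * (f * o2) + of_real (b * b) * (f * w)"
        by (simp add: algebra_simps)
      also have "\<dots> = of_real (H * d + r2 * d) * (o1 * o2) + of_real (K - H - r2 * d) * (o1 * w)
          + of_real (- H * d - r2 + r3) * (f * o2) + of_real (H - K + r2 + r3) * (f * w)"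
        using c1 c2 c3 c4 by (simp only:)
      finally show ?thesis
        by (simp add: algebra_simps)
    qed
    show ?thesis
      unfolding Q_def P_def H_def[symmetric] K_def[symmetric] partial_transpose_add partial_transpose_scaleR
        partial_transpose_shuffle partial_transpose_diff partial_transpose_flip partial_transpose_max_ent partial_transpose_mat
      by (simp add: vec_eq_iff del: max_ent_nth flip_mat_nth mat_prod_nth) (simp add: scaleR_conv_of_real key del: max_ent_nth flip_mat_nth mat_prod_nth)
  qed
  ultimately show ?thesis by blast
qed

text \<open>Weak duality: a positive semidefinite \<open>S\<close> with positive semidefinite
  partial transpose pairs nonnegatively with every \<open>P + partial_transpose Q\<close>. Its
  pairing with the given matrix is a positive multiple of the expression in
  \<open>crit\<close>.\<close>

lemma shuffle_werner_no_decomposition: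
  fixes s r :: real and P Q :: "(('n::finite \<times> 'n) \<times> ('n \<times> 'n)) cmat"
  defines "d \<equiv> real CARD('n)"
  defines "a \<equiv> (s + r) / 2" and "b \<equiv> (s - r) / 2"
  assumes "d \<ge> 2" and crit: "r * (a + b * d) + (d + 1) * s * a < 0"
    and "psd P" "psd Q"
  shows "shuffle (a *\<^sub>R mat 1 + b *\<^sub>R flip_mat :: ('n \<times> 'n) cmat) (a *\<^sub>R mat 1 + b *\<^sub>R max_ent :: ('n \<times> 'n) cmat) \<noteq> P + partial_transpose Q"
proof
  let ?I = "mat 1 :: ('n \<times> 'n) cmat"
  let ?F = "flip_mat :: ('n \<times> 'n) cmat"
  let ?w = "max_ent :: ('n \<times> 'n) cmat"
  let ?C = "shuffle (a *\<^sub>R ?I + b *\<^sub>R ?F) (a *\<^sub>R ?I + b *\<^sub>R ?w)"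
  assume C: "?C = P + partial_transpose Q"
  \<comment> \<open>The dual optimum: it pairs to zero with both summands of \<open>Q\<^sup>\<Gamma>\<close> in the decomposition above.\<close>
  define S where "S = shuffle (?I + ?F) (d *\<^sub>R ?I - ?w) + (d + 1) *\<^sub>R shuffle (?I - ?F) ?w"
  define S' where "S' = shuffle (d *\<^sub>R ?I - ?w) (?I + ?F) + (d + 1) *\<^sub>R shuffle ?w (?I - ?F)"
  have "psd S" "psd S'"
    unfolding S_def S'_def using assms psd_max_ent_complement[where 'n = 'n]
    by (auto intro!: psd_shuffle psd_flip psd_add psd_scaleR psd_max_ent)
  \<comment> \<open>Partial transposition exchanges flip and \<open>max_ent\<close> in both factors.
    The weight \<open>d + 1\<close> is the largest for which the result stays positive semidefinite;
    there it is \<open>S\<close> with its two tensor factors exchanged.\<close>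
  have "partial_transpose S = S'"
  proof -
    have "(o1 + w1) * (d *\<^sub>R o2 - f2) + (d + 1) *\<^sub>R ((o1 - w1) * f2) =
        (d *\<^sub>R o1 - w1) * (o2 + f2) + (d + 1) *\<^sub>R (w1 * (o2 - f2))" for o1 w1 o2 f2 :: complex
      by (simp add: scaleR_conv_of_real algebra_simps)
    then show ?thesis
      unfolding S_def S'_def partial_transpose_add partial_transpose_scaleR partial_transpose_shuffle
        partial_transpose_diff partial_transpose_flip partial_transpose_max_ent partial_transpose_mat
      by (simp add: vec_eq_iff del: max_ent_nth flip_mat_nth mat_prod_nth)
  qed
  have "trace (S ** ?C) = trace (S ** P) + trace (S' ** Q)"
    unfolding C \<open>partial_transpose S = S'\<close>[symmetric] trace_partial_transpose_mult
    by (simp add: matrix_add_ldistrib trace_add)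
  moreover have "trace (S ** P) \<in> \<real>\<^sub>\<ge>\<^sub>0" "trace (S' ** Q) \<in> \<real>\<^sub>\<ge>\<^sub>0"
    using assms \<open>psd S\<close> \<open>psd S'\<close> by (auto intro: psd_trace_mult)
  ultimately have nonneg: "0 \<le> Re (trace (S ** ?C))"
    by (simp add: complex_nonneg_Reals_iff)
  have t1: "trace ((?I + ?F) ** (a *\<^sub>R ?I + b *\<^sub>R ?F)) = of_real (s * (d\<^sup>2 + d))"
    by (simp add: mat_mult_simps trace_add trace_scaleR trace_I trace_flip a_def b_def d_def)
       (simp add: power2_eq_square algebra_simps add_divide_distrib diff_divide_distrib)
  have t2: "trace ((?I - ?F) ** (a *\<^sub>R ?I + b *\<^sub>R ?F)) = of_real (r * (d\<^sup>2 - d))"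
    by (simp add: mat_mult_simps trace_add trace_sub trace_scaleR trace_I trace_flip a_def b_def d_def)
       (simp add: power2_eq_square algebra_simps add_divide_distrib diff_divide_distrib)
  have t3: "trace ((d *\<^sub>R ?I - ?w) ** (a *\<^sub>R ?I + b *\<^sub>R ?w)) = of_real (a * (d * d\<^sup>2 - d))"
    by (simp add: mat_mult_simps trace_add trace_sub trace_scaleR trace_I trace_max_ent d_def)
       (simp add: power2_eq_square algebra_simps)
  have t4: "trace (?w ** (a *\<^sub>R ?I + b *\<^sub>R ?w)) = of_real ((a + b * d) * d)"
    by (simp add: mat_mult_simps trace_add trace_scaleR trace_max_ent d_def algebra_simps)
  have "trace (S ** ?C) = of_real (s * (d\<^sup>2 + d) * (a * (d * d\<^sup>2 - d)) + (d + 1) * (r * (d\<^sup>2 - d) * ((a + b * d) * d)))"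
  proof -
    have "trace ((X + c *\<^sub>R Y) ** Z) = trace (X ** Z) + of_real c * trace (Y ** Z)"
      for X Y Z :: "(('n \<times> 'n) \<times> ('n \<times> 'n)) cmat" and c
      by (simp add: mult_add_mat scaleR_mult_mat trace_add trace_scaleR)
    then show ?thesis
      unfolding S_def by (simp only: trace_shuffle_mult t1 t2 t3 t4 of_real_mult of_real_add)
  qed
  also have "s * (d\<^sup>2 + d) * (a * (d * d\<^sup>2 - d)) + (d + 1) * (r * (d\<^sup>2 - d) * ((a + b * d) * d)) =
      d\<^sup>2 * (d - 1) * (d + 1) * (r * (a + b * d) + (d + 1) * s * a)"
    by (simp add: power2_eq_square algebra_simps)
  finally have "Re (trace (S ** ?C)) = d\<^sup>2 * (d - 1) * (d + 1) * (r * (a + b * d) + (d + 1) * s * a)"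
    by simp
  also have "\<dots> < 0"
    using assms by (intro mult_pos_neg) auto
  finally show False
    using nonneg by simp
qed

subsection \<open>Positivity\<close>

lemma trace_mult_dagger: "trace (M ** dagger M) = of_real (\<Sum>i\<in>UNIV. \<Sum>j\<in>UNIV. (cmod (M $ i $ j))\<^sup>2)"
  by (simp add: trace_mult complex_norm_square[symmetric])

lemma cnj_mat_mult: "cnj_mat (A ** B) = cnj_mat A ** cnj_mat B"
  by (simp add: vec_eq_iff matrix_matrix_mult_def)

lemma cnj_mat_dagger: "cnj_mat (dagger A) = transpose A"
  and dagger_cnj_mat: "dagger (cnj_mat A) = transpose A"
  and transpose_dagger: "transpose (dagger A) = cnj_mat A"
  and cnj_mat_cnj_mat: "cnj_mat (cnj_mat A) = A"
  by (simp_all add: vec_eq_iff transpose_def)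

lemma trace_conjugate: "Q ** P = mat 1 \<Longrightarrow> trace (P ** M ** Q) = trace (M :: 'n::finite cmat)"
  by (metis matrix_mul_assoc matrix_mul_lid trace_mul_sym)

definition rank_one :: "complex ^ 'n \<Rightarrow> 'n::finite cmat" where
  "rank_one x = (\<chi> i j. x $ i * cnj (x $ j))"

lemma psd_rank_one: "psd (rank_one x)"
  unfolding psd_cip
proof
  fix v
  have "cip v (rank_one x *v v) = cip v x * cip x v"
    unfolding cip_mult_vec by (simp only: cip_def sum_product rank_one_def vec_lambda_beta mult.assoc)
  then have "cip v (rank_one x *v v) = cnj (cip x v) * cip x v"
    by (simp add: cip_cnj)
  then show "cip v (rank_one x *v v) \<in> \<real>\<^sub>\<ge>\<^sub>0"
    by (metis cnj_mult_self_nonneg)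
qed

text \<open>By the spectral form, every positive semidefinite argument is a nonnegative combination
  of rank-one ones.\<close>

lemma positive_map_if_rank_one:
  fixes L :: "'n::finite cmat \<Rightarrow> 'm::finite cmat"
  assumes "complex_linear L" "\<And>x. psd (L (rank_one x))"
  shows "positive_map L"
  unfolding positive_map_def
proof (intro conjI allI impI)
  fix A :: "'n cmat"
  assume "psd A"
  obtain c :: "'n \<Rightarrow> real" and v where
    *: "(\<forall>m. 0 \<le> c m) \<and> (\<forall>i j. A $ i $ j = (\<Sum>m\<in>UNIV. of_real (c m) * (v m $ i * cnj (v m $ j))))"
    using psd_spectral[OF \<open>psd A\<close>] by (elim exE)
  note cv = conjunct1[OF *, THEN spec] conjunct2[OF *, THEN spec, THEN spec]
  have "A = (\<Sum>m\<in>UNIV. smult_mat (of_real (c m)) (rank_one (v m)))"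
    by (simp add: vec_eq_iff rank_one_def cv(2))
  then have "L A = (\<Sum>m\<in>UNIV. smult_mat (of_real (c m)) (L (rank_one (v m))))"
    using assms(1) by (simp add: complex_linear_sum) (simp add: complex_linear_iff)
  also have "\<dots> = (\<Sum>m\<in>UNIV. c m *\<^sub>R L (rank_one (v m)))"
    by (simp add: vec_eq_iff) (simp add: scaleR_conv_of_real)
  also have "psd \<dots>"
  proof -
    have "psd (\<Sum>m\<in>S. c m *\<^sub>R L (rank_one (v m)))" if "finite S" for S
      using that
    proof induction
      case empty
      show ?case by (simp add: psd_cip)
    qed (simp add: psd_add psd_scaleR cv assms(2))
    then show ?thesis by simp
  qed
  finally show "psd (L A)" .
qed (rule assms(1))

section \<open>The quadratic form on product vectors as traces of matrix products\<close>

definition mat_of_vec :: "complex ^ ('n \<times> 'm) \<Rightarrow> complex ^ 'm ^ 'n" where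
  "mat_of_vec x = (\<chi> i j. x $ (i, j))"

lemma mat_of_vec_nth [simp]: "mat_of_vec x $ i $ j = x $ (i, j)"
  by (simp add: mat_of_vec_def)

lemma sum4_swap23: "(\<Sum>a\<in>A. \<Sum>b\<in>B. \<Sum>c\<in>C. \<Sum>d\<in>D. f a b c d) = (\<Sum>a\<in>A. \<Sum>c\<in>C. \<Sum>b\<in>B. \<Sum>d\<in>D. f a b c d)"
  by (intro sum.cong refl sum.swap)

lemma sum4_swap34: "(\<Sum>a\<in>A. \<Sum>b\<in>B. \<Sum>c\<in>C. \<Sum>d\<in>D. f a b c d) = (\<Sum>a\<in>A. \<Sum>b\<in>B. \<Sum>d\<in>D. \<Sum>c\<in>C. f a b c d)"
  by (intro sum.cong refl sum.swap)

text \<open>\<open>mat 1\<close>, \<open>flip_mat\<close> and \<open>max_ent\<close> are the Choi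
  matrices of the trace times the identity, of transposition and of the identity map. The four terms
  are therefore the full trace, the two partial traces (the second one transposed), and the
  transposition of the first factor.\<close>

lemma shuffle_map_nth:
  fixes L :: "('n::finite \<times> 'n) cmat \<Rightarrow> ('n \<times> 'n) cmat"
  assumes "complex_linear L"
    and choi: "choi L = shuffle (a *\<^sub>R mat 1 + b *\<^sub>R flip_mat :: ('n \<times> 'n) cmat) (a *\<^sub>R mat 1 + b *\<^sub>R max_ent)"
  shows "L X $ (k, m) $ (l, n) =
    of_real (a\<^sup>2) * (if k = l \<and> m = n then trace X else 0)
    + of_real (a * b) * (if k = l then \<Sum>i\<in>UNIV. X $ (i, m) $ (i, n) else 0)
    + of_real (a * b) * (if m = n then \<Sum>i\<in>UNIV. X $ (l, i) $ (k, i) else 0)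
    + of_real (b\<^sup>2) * X $ (l, m) $ (k, n)"
proof -
  let ?S = "\<lambda>f. \<Sum>i\<in>(UNIV::'n set). \<Sum>c\<in>(UNIV::'n set). \<Sum>j\<in>(UNIV::'n set). \<Sum>e\<in>(UNIV::'n set). f i c j e :: complex"
  have "L X $ (k, m) $ (l, n) = ?S (\<lambda>i c j e. X $ (i, c) $ (j, e) * choi L $ ((i, c), (k, m)) $ ((j, e), (l, n)))"
    by (simp add: complex_linear_choi[OF assms(1)] sum_UNIV_prod)
  also have "\<dots> = ?S (\<lambda>i c j e.
      of_real (a\<^sup>2) * (if i = j \<and> k = l \<and> c = e \<and> m = n then X $ (i, c) $ (j, e) else 0)
      + of_real (a * b) * (if i = j \<and> k = l \<and> c = m \<and> e = n then X $ (i, c) $ (j, e) else 0)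
      + of_real (a * b) * (if i = l \<and> k = j \<and> c = e \<and> m = n then X $ (i, c) $ (j, e) else 0)
      + of_real (b\<^sup>2) * (if i = l \<and> k = j \<and> c = m \<and> e = n then X $ (i, c) $ (j, e) else 0))"
  proof (intro sum.cong refl)
    fix i c j e :: 'n
    have *: "x * ((a *\<^sub>R o1 + b *\<^sub>R f) * (a *\<^sub>R o2 + b *\<^sub>R w)) =
        of_real (a\<^sup>2) * (o1 * o2 * x) + of_real (a * b) * (o1 * w * x) + of_real (a * b) * (f * o2 * x) + of_real (b\<^sup>2) * (f * w * x)"
      for x o1 f o2 w :: complex
      by (simp add: scaleR_conv_of_real power2_eq_square algebra_simps)
    show "X $ (i, c) $ (j, e) * choi L $ ((i, c), (k, m)) $ ((j, e), (l, n)) =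
      of_real (a\<^sup>2) * (if i = j \<and> k = l \<and> c = e \<and> m = n then X $ (i, c) $ (j, e) else 0)
      + of_real (a * b) * (if i = j \<and> k = l \<and> c = m \<and> e = n then X $ (i, c) $ (j, e) else 0)
      + of_real (a * b) * (if i = l \<and> k = j \<and> c = e \<and> m = n then X $ (i, c) $ (j, e) else 0)
      + of_real (b\<^sup>2) * (if i = l \<and> k = j \<and> c = m \<and> e = n then X $ (i, c) $ (j, e) else 0)"
      unfolding choi shuffle_nth vector_add_component vector_scaleR_component *
      by (intro arg_cong2[where f = "(+)"] arg_cong2[where f = "(*)"] refl) auto
  qed
  also have "\<dots> = of_real (a\<^sup>2) * ?S (\<lambda>i c j e. if i = j \<and> k = l \<and> c = e \<and> m = n then X $ (i, c) $ (j, e) else 0)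
      + of_real (a * b) * ?S (\<lambda>i c j e. if i = j \<and> k = l \<and> c = m \<and> e = n then X $ (i, c) $ (j, e) else 0)
      + of_real (a * b) * ?S (\<lambda>i c j e. if i = l \<and> k = j \<and> c = e \<and> m = n then X $ (i, c) $ (j, e) else 0)
      + of_real (b\<^sup>2) * ?S (\<lambda>i c j e. if i = l \<and> k = j \<and> c = m \<and> e = n then X $ (i, c) $ (j, e) else 0)"
    by (simp only: sum.distrib sum_distrib_left)
  \<comment> \<open>Each equation between indices is moved next to the sum that it
    collapses.\<close>
  also have "?S (\<lambda>i c j e. if i = j \<and> k = l \<and> c = e \<and> m = n then X $ (i, c) $ (j, e) else 0) =
      (\<Sum>i\<in>UNIV. \<Sum>c\<in>UNIV. \<Sum>j\<in>UNIV. if j = i then \<Sum>e\<in>UNIV. if e = c then if k = l \<and> m = n then X $ (i, c) $ (i, c) else 0 else 0 else 0)"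
    by (intro sum.cong refl) (auto intro!: sum.cong sum.neutral simp del: sum.delta sum.delta')
  also have "\<dots> = (if k = l \<and> m = n then trace X else 0)"
    by (cases "k = l \<and> m = n") (auto simp: trace_def sum_UNIV_prod)
  also have "?S (\<lambda>i c j e. if i = j \<and> k = l \<and> c = m \<and> e = n then X $ (i, c) $ (j, e) else 0) =
      (\<Sum>i\<in>UNIV. \<Sum>c\<in>UNIV. if c = m then \<Sum>j\<in>UNIV. if j = i then \<Sum>e\<in>UNIV. if e = n then if k = l then X $ (i, m) $ (i, n) else 0 else 0 else 0 else 0)"
    by (intro sum.cong refl) (auto intro!: sum.cong sum.neutral simp del: sum.delta sum.delta')
  also have "\<dots> = (if k = l then \<Sum>i\<in>UNIV. X $ (i, m) $ (i, n) else 0)"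
    by simp
  also have "?S (\<lambda>i c j e. if i = l \<and> k = j \<and> c = e \<and> m = n then X $ (i, c) $ (j, e) else 0) =
      (\<Sum>i\<in>UNIV. if i = l then \<Sum>c\<in>UNIV. \<Sum>j\<in>UNIV. if j = k then \<Sum>e\<in>UNIV. if e = c then if m = n then X $ (l, c) $ (k, c) else 0 else 0 else 0 else 0)"
    by (intro sum.cong refl) (auto intro!: sum.cong sum.neutral simp del: sum.delta sum.delta')
  also have "\<dots> = (if m = n then \<Sum>i\<in>UNIV. X $ (l, i) $ (k, i) else 0)"
    by simp
  also have "?S (\<lambda>i c j e. if i = l \<and> k = j \<and> c = m \<and> e = n then X $ (i, c) $ (j, e) else 0) =
      (\<Sum>i\<in>UNIV. if i = l then \<Sum>c\<in>UNIV. if c = m then \<Sum>j\<in>UNIV. if j = k then \<Sum>e\<in>UNIV. if e = n then X $ (l, m) $ (k, n) else 0 else 0 else 0 else 0)"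
    by (intro sum.cong refl) (auto intro!: sum.cong sum.neutral simp del: sum.delta sum.delta')
  also have "\<dots> = X $ (l, m) $ (k, n)"
    by simp
  finally show ?thesis .
qed

text \<open>Reshaping \<open>x\<close> and \<open>y\<close> into matrices turns partial traces into
  matrix products. In terms of \<open>Y ** dagger X\<close> and \<open>transpose X ** Y\<close> the
  form can be simplified by unitary changes of basis.\<close>

lemma shuffle_map_rank_one:
  fixes L :: "('n::finite \<times> 'n) cmat \<Rightarrow> ('n \<times> 'n) cmat" and x y :: "complex ^ ('n \<times> 'n)"
  defines "X \<equiv> mat_of_vec x" and "Y \<equiv> mat_of_vec y"
  assumes "complex_linear L"
    and choi: "choi L = shuffle (a *\<^sub>R mat 1 + b *\<^sub>R flip_mat :: ('n \<times> 'n) cmat) (a *\<^sub>R mat 1 + b *\<^sub>R max_ent)"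
  shows "cip y (L (rank_one x) *v y) =
    of_real (a\<^sup>2) * (trace (X ** dagger X) * trace (Y ** dagger Y))
    + of_real (a * b) * trace ((Y ** dagger X) ** dagger (Y ** dagger X))
    + of_real (a * b) * trace ((transpose X ** Y) ** dagger (transpose X ** Y))
    + of_real (b\<^sup>2) * trace ((Y ** dagger X) ** cnj_mat (Y ** dagger X))"
proof -
  let ?S = "\<lambda>f. \<Sum>k\<in>(UNIV::'n set). \<Sum>m\<in>(UNIV::'n set). \<Sum>l\<in>(UNIV::'n set). \<Sum>n\<in>(UNIV::'n set). f k m l n :: complex"
  have "cip y (L (rank_one x) *v y) = ?S (\<lambda>k m l n. cnj (Y $ k $ m) * L (rank_one x) $ (k, m) $ (l, n) * Y $ l $ n)"
    by (simp add: cip_mult_vec sum_UNIV_prod Y_def)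
  also have "\<dots> = ?S (\<lambda>k m l n.
      of_real (a\<^sup>2) * (if k = l \<and> m = n then trace (X ** dagger X) * (cnj (Y $ k $ m) * Y $ l $ n) else 0)
      + of_real (a * b) * (if k = l then cnj (Y $ k $ m) * (\<Sum>i\<in>UNIV. X $ i $ m * cnj (X $ i $ n)) * Y $ l $ n else 0)
      + of_real (a * b) * (if m = n then cnj (Y $ k $ m) * (\<Sum>i\<in>UNIV. X $ l $ i * cnj (X $ k $ i)) * Y $ l $ n else 0)
      + of_real (b\<^sup>2) * (cnj (Y $ k $ m) * X $ l $ m * cnj (X $ k $ n) * Y $ l $ n))"
  proof -
    have "trace (rank_one x) = trace (X ** dagger X)"
      by (simp add: trace_def sum_UNIV_prod rank_one_def matrix_matrix_mult_def X_def)
    then have "cnj (Y $ k $ m) * L (rank_one x) $ (k, m) $ (l, n) * Y $ l $ n =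
      of_real (a\<^sup>2) * (if k = l \<and> m = n then trace (X ** dagger X) * (cnj (Y $ k $ m) * Y $ l $ n) else 0)
      + of_real (a * b) * (if k = l then cnj (Y $ k $ m) * (\<Sum>i\<in>UNIV. X $ i $ m * cnj (X $ i $ n)) * Y $ l $ n else 0)
      + of_real (a * b) * (if m = n then cnj (Y $ k $ m) * (\<Sum>i\<in>UNIV. X $ l $ i * cnj (X $ k $ i)) * Y $ l $ n else 0)
      + of_real (b\<^sup>2) * (cnj (Y $ k $ m) * X $ l $ m * cnj (X $ k $ n) * Y $ l $ n)" for k m l n
      unfolding shuffle_map_nth[OF assms(3) choi]
      by (simp add: rank_one_def X_def distrib_left distrib_right mult_ac)
    then show ?thesis by simp
  qed
  also have "\<dots> =
      of_real (a\<^sup>2) * ?S (\<lambda>k m l n. if k = l \<and> m = n then trace (X ** dagger X) * (cnj (Y $ k $ m) * Y $ l $ n) else 0)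
      + of_real (a * b) * ?S (\<lambda>k m l n. if k = l then cnj (Y $ k $ m) * (\<Sum>i\<in>UNIV. X $ i $ m * cnj (X $ i $ n)) * Y $ l $ n else 0)
      + of_real (a * b) * ?S (\<lambda>k m l n. if m = n then cnj (Y $ k $ m) * (\<Sum>i\<in>UNIV. X $ l $ i * cnj (X $ k $ i)) * Y $ l $ n else 0)
      + of_real (b\<^sup>2) * ?S (\<lambda>k m l n. cnj (Y $ k $ m) * X $ l $ m * cnj (X $ k $ n) * Y $ l $ n)"
    by (simp only: sum.distrib sum_distrib_left)
  also have "?S (\<lambda>k m l n. if k = l \<and> m = n then trace (X ** dagger X) * (cnj (Y $ k $ m) * Y $ l $ n) else 0) =
      (\<Sum>k\<in>UNIV. \<Sum>m\<in>UNIV. \<Sum>l\<in>UNIV. if l = k then \<Sum>n\<in>UNIV. if n = m then trace (X ** dagger X) * (cnj (Y $ k $ m) * Y $ k $ m) else 0 else 0)"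
    by (intro sum.cong refl) (auto intro!: sum.cong sum.neutral simp del: sum.delta sum.delta')
  also have "\<dots> = trace (X ** dagger X) * trace (Y ** dagger Y)"
    by (simp add: trace_mult[of Y] sum_distrib_left mult_ac)
  also have "?S (\<lambda>k m l n. if k = l then cnj (Y $ k $ m) * (\<Sum>i\<in>UNIV. X $ i $ m * cnj (X $ i $ n)) * Y $ l $ n else 0) =
      (\<Sum>k\<in>UNIV. \<Sum>m\<in>UNIV. \<Sum>l\<in>UNIV. if l = k then \<Sum>n\<in>UNIV. cnj (Y $ k $ m) * (\<Sum>i\<in>UNIV. X $ i $ m * cnj (X $ i $ n)) * Y $ k $ n else 0)"
    by (intro sum.cong refl) (auto intro!: sum.cong sum.neutral simp del: sum.delta sum.delta')
  also have "\<dots> = (\<Sum>k\<in>UNIV. \<Sum>m\<in>UNIV. \<Sum>n\<in>UNIV. \<Sum>i\<in>UNIV. Y $ k $ n * cnj (X $ i $ n) * cnj (Y $ k $ m * cnj (X $ i $ m)))"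
    by (simp add: sum_distrib_left sum_distrib_right mult_ac)
  \<comment> \<open>The two outer indices now name an entry of \<open>Y ** dagger X\<close>; the two
    inner sums are the matrix products in that entry and its conjugate.\<close>
  also have "\<dots> = (\<Sum>k\<in>UNIV. \<Sum>i\<in>UNIV. \<Sum>n\<in>UNIV. \<Sum>m\<in>UNIV. Y $ k $ n * cnj (X $ i $ n) * cnj (Y $ k $ m * cnj (X $ i $ m)))"
    by (subst sum4_swap34, subst sum4_swap23, subst sum4_swap34) (rule refl)
  also have "\<dots> = trace ((Y ** dagger X) ** dagger (Y ** dagger X))"
    by (simp add: trace_mult[of "Y ** dagger X"]) (simp add: matrix_matrix_mult_def sum_product)
  also have "?S (\<lambda>k m l n. if m = n then cnj (Y $ k $ m) * (\<Sum>i\<in>UNIV. X $ l $ i * cnj (X $ k $ i)) * Y $ l $ n else 0) =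
      (\<Sum>k\<in>UNIV. \<Sum>m\<in>UNIV. \<Sum>l\<in>UNIV. \<Sum>n\<in>UNIV. if n = m then cnj (Y $ k $ m) * (\<Sum>i\<in>UNIV. X $ l $ i * cnj (X $ k $ i)) * Y $ l $ m else 0)"
    by (intro sum.cong refl) (auto intro!: sum.cong sum.neutral simp del: sum.delta sum.delta')
  also have "\<dots> = (\<Sum>k\<in>UNIV. \<Sum>m\<in>UNIV. \<Sum>l\<in>UNIV. \<Sum>i\<in>UNIV. X $ l $ i * Y $ l $ m * cnj (X $ k $ i * Y $ k $ m))"
    by (simp add: sum_distrib_left sum_distrib_right mult_ac)
  also have "\<dots> = (\<Sum>i\<in>UNIV. \<Sum>m\<in>UNIV. \<Sum>l\<in>UNIV. \<Sum>k\<in>UNIV. X $ l $ i * Y $ l $ m * cnj (X $ k $ i * Y $ k $ m))"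
    by (subst sum4_swap34, subst sum4_swap23, subst sum.swap, subst sum4_swap23, subst sum4_swap34) (rule refl)
  also have "\<dots> = trace ((transpose X ** Y) ** dagger (transpose X ** Y))"
    by (simp add: trace_mult[of "transpose X ** Y"]) (simp add: matrix_matrix_mult_def sum_product transpose_def)
  also have "?S (\<lambda>k m l n. cnj (Y $ k $ m) * X $ l $ m * cnj (X $ k $ n) * Y $ l $ n) =
      (\<Sum>k\<in>UNIV. \<Sum>m\<in>UNIV. \<Sum>l\<in>UNIV. \<Sum>n\<in>UNIV. Y $ l $ n * cnj (X $ k $ n) * cnj (Y $ k $ m * cnj (X $ l $ m)))"
    by (simp add: mult_ac)
  also have "\<dots> = (\<Sum>l\<in>UNIV. \<Sum>k\<in>UNIV. \<Sum>n\<in>UNIV. \<Sum>m\<in>UNIV. Y $ l $ n * cnj (X $ k $ n) * cnj (Y $ k $ m * cnj (X $ l $ m)))"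
    by (subst sum4_swap23, subst sum.swap, subst sum4_swap34) (rule refl)
  also have "\<dots> = trace ((Y ** dagger X) ** cnj_mat (Y ** dagger X))"
    by (simp add: trace_mult[of "Y ** dagger X"]) (simp add: matrix_matrix_mult_def sum_product)
  finally show ?thesis .
qed

text \<open>In the singular bases of \<open>X\<close> only the entries \<open>N $ i $ j\<close> and
  \<open>N $ j $ i\<close> interact, so the form splits into summands that can be bounded pair by
  pair.\<close>

lemma shuffle_map_psd_rank_one:
  fixes L :: "('n::finite \<times> 'n) cmat \<Rightarrow> ('n \<times> 'n) cmat"
  assumes "complex_linear L"
    and choi: "choi L = shuffle (a *\<^sub>R mat 1 + b *\<^sub>R flip_mat :: ('n \<times> 'n) cmat) (a *\<^sub>R mat 1 + b *\<^sub>R max_ent)"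
    and ab: "0 \<le> a" "b \<le> 0" "0 \<le> a + b" "b\<^sup>2 \<le> 2 * a * (a + b)"
  shows "psd (L (rank_one x))"
  unfolding psd_cip
proof
  fix y :: "complex ^ ('n \<times> 'n)"
  define X where "X = mat_of_vec x"
  define Y where "Y = mat_of_vec y"
  obtain U V :: "'n cmat" and m :: "'n \<Rightarrow> real" where
    U: "dagger U ** U = mat 1" "U ** dagger U = mat 1"
    and V: "dagger V ** V = mat 1" "V ** dagger V = mat 1" and m: "\<And>i. 0 \<le> m i"
    and X: "X = U ** diag_mat (\<lambda>i. of_real (m i)) ** dagger V"
    by (rule singular_value_decomposition[of X], rule that)
  define D where "D = diag_mat (\<lambda>i. complex_of_real (m i))"
  have D: "dagger D = D" "transpose D = D" "cnj_mat D = D"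
    by (auto simp: D_def vec_eq_iff diag_mat_def transpose_def)
  \<comment> \<open>\<open>Y\<close> meets \<open>X\<close> through both
    \<open>Y ** dagger X\<close> and \<open>transpose X ** Y\<close>. This change of basis
    diagonalises \<open>X\<close> in both at once, leaving \<open>N ** D\<close> and
    \<open>D ** N\<close> between unitaries.\<close>
  define N where "N = transpose U ** Y ** V"
  have conj1: "cnj_mat A ** transpose A = mat 1" if "A ** dagger A = mat 1" for A :: "'n cmat"
    using arg_cong[OF that, of cnj_mat]
    by (simp add: cnj_mat_mult cnj_mat_dagger) (simp add: vec_eq_iff mat_def)
  have conj2: "transpose A ** cnj_mat A = mat 1" if "A ** dagger A = mat 1" for A :: "'n cmat"
    using conj1[OF that] by (rule matrix_left_right_inverse1)
  have Y: "Y = cnj_mat U ** N ** dagger V"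
    unfolding N_def using conj1[OF U(2)] V(2)
    by (metis matrix_mul_assoc matrix_mul_lid matrix_mul_rid)
  have YX: "Y ** dagger X = cnj_mat U ** (N ** D) ** dagger U"
  proof -
    have "Y ** dagger X = cnj_mat U ** N ** (dagger V ** V) ** D ** dagger U"
      unfolding X Y D_def[symmetric] by (simp add: dagger_mult D matrix_mul_assoc)
    then show ?thesis
      by (simp add: V matrix_mul_assoc)
  qed
  have XY: "transpose X ** Y = cnj_mat V ** (D ** N) ** dagger V"
  proof -
    have "transpose X ** Y = cnj_mat V ** D ** (transpose U ** cnj_mat U) ** N ** dagger V"
      unfolding X Y D_def[symmetric] by (simp add: matrix_transpose_mul transpose_dagger D matrix_mul_assoc)
    then show ?thesis
      by (simp add: conj2[OF U(2)] matrix_mul_assoc)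
  qed
  \<comment> \<open>Unitary invariance of the Hilbert-Schmidt norm.\<close>
  have tr: "trace ((cnj_mat A ** M ** dagger B) ** dagger (cnj_mat A ** M ** dagger B)) = trace (M ** dagger M)"
    if "A ** dagger A = mat 1" "dagger B ** B = mat 1" for A B M :: "'n cmat"
  proof -
    have "(cnj_mat A ** M ** dagger B) ** dagger (cnj_mat A ** M ** dagger B) =
        cnj_mat A ** M ** (dagger B ** B) ** dagger M ** transpose A"
      by (simp add: dagger_mult dagger_cnj_mat matrix_mul_assoc)
    also have "\<dots> = cnj_mat A ** (M ** dagger M) ** transpose A"
      by (simp add: that matrix_mul_assoc)
    finally show ?thesis
      by (simp add: trace_conjugate conj2[OF that(1)])
  qed
  define S where "S = (\<Sum>i\<in>UNIV. (m i)\<^sup>2)"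
  define g where "g i j = (cmod (N $ i $ j))\<^sup>2" for i j
  have t1: "trace (X ** dagger X) * trace (Y ** dagger Y) = of_real (\<Sum>i\<in>UNIV. \<Sum>j\<in>UNIV. S * g i j)"
  proof -
    have "X ** dagger X = U ** (D ** D) ** dagger U"
    proof -
      have "X ** dagger X = U ** D ** (dagger V ** V) ** D ** dagger U"
        unfolding X D_def[symmetric] by (simp add: dagger_mult D matrix_mul_assoc)
      then show ?thesis by (simp add: V matrix_mul_assoc)
    qed
    then have "trace (X ** dagger X) = trace (D ** D)"
      by (simp add: trace_conjugate U)
    also have "\<dots> = of_real S"
      unfolding trace_def D_def mult_diag_mat by (simp add: diag_mat_def S_def power2_eq_square)
    finally have "trace (X ** dagger X) = of_real S" .
    moreover have "trace (Y ** dagger Y) = trace (N ** dagger N)"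
      unfolding Y by (rule tr[OF U(2) V(1)])
    ultimately show ?thesis
      by (simp add: trace_mult_dagger g_def sum_distrib_left)
  qed
  have t2: "trace ((Y ** dagger X) ** dagger (Y ** dagger X)) = of_real (\<Sum>i\<in>UNIV. \<Sum>j\<in>UNIV. (m j)\<^sup>2 * g i j)"
    unfolding YX tr[OF U(2) U(1)] unfolding trace_mult_dagger D_def mult_diag_mat
    by (simp add: norm_mult power_mult_distrib g_def mult.commute)
  have t3: "trace ((transpose X ** Y) ** dagger (transpose X ** Y)) = of_real (\<Sum>i\<in>UNIV. \<Sum>j\<in>UNIV. (m i)\<^sup>2 * g i j)"
    unfolding XY tr[OF V(2) V(1)] unfolding trace_mult_dagger D_def mult_diag_mat
    by (simp add: norm_mult power_mult_distrib g_def)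
  define h where "h i j = Re (N $ i $ j * cnj (N $ j $ i))" for i j
  have t4: "trace ((Y ** dagger X) ** cnj_mat (Y ** dagger X)) = of_real (\<Sum>i\<in>UNIV. \<Sum>j\<in>UNIV. m i * m j * h i j)"
  proof -
    have "(Y ** dagger X) ** cnj_mat (Y ** dagger X) =
        cnj_mat U ** (N ** D) ** (dagger U ** U) ** cnj_mat (N ** D) ** transpose U"
      unfolding YX by (simp add: cnj_mat_mult cnj_mat_cnj_mat cnj_mat_dagger matrix_mul_assoc)
    also have "\<dots> = cnj_mat U ** (N ** D ** cnj_mat (N ** D)) ** transpose U"
      by (simp add: U matrix_mul_assoc)
    finally have "trace ((Y ** dagger X) ** cnj_mat (Y ** dagger X)) = trace (N ** D ** cnj_mat (N ** D))"
      by (simp add: trace_conjugate conj2[OF U(2)])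
    also have "\<dots> = (\<Sum>i\<in>UNIV. \<Sum>j\<in>UNIV. of_real (m i * m j) * (N $ i $ j * cnj (N $ j $ i)))"
      unfolding trace_mult D_def cnj_mat_nth mult_diag_mat by (simp add: mult_ac)
    finally have *: "trace ((Y ** dagger X) ** cnj_mat (Y ** dagger X)) =
        (\<Sum>i\<in>UNIV. \<Sum>j\<in>UNIV. of_real (m i * m j) * (N $ i $ j * cnj (N $ j $ i)))" .
    have real: "Im w = 0" if "cnj w = w" for w
      using that by (simp add: complex_eq_iff)
    \<comment> \<open>Exchanging \<open>i\<close> and \<open>j\<close> conjugates the summands, so
      the double sum is real and only the real parts \<open>h i j\<close> survive.\<close>
    have "cnj (\<Sum>i\<in>UNIV. \<Sum>j\<in>UNIV. of_real (m i * m j) * (N $ i $ j * cnj (N $ j $ i))) =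
        (\<Sum>i\<in>UNIV. \<Sum>j\<in>UNIV. of_real (m i * m j) * (N $ i $ j * cnj (N $ j $ i)))"
      by (subst (2) sum.swap) (simp add: mult_ac)
    then have "Im (\<Sum>i\<in>UNIV. \<Sum>j\<in>UNIV. of_real (m i * m j) * (N $ i $ j * cnj (N $ j $ i))) = 0"
      by (rule real)
    moreover have "Re (of_real (m i * m j) * (N $ i $ j * cnj (N $ j $ i))) = m i * m j * h i j" for i j
      by (simp only: Re_complex_of_real Im_complex_of_real times_complex.sel(1) h_def)
    ultimately show ?thesis
      unfolding * by (simp only: complex_eq_iff Re_complex_of_real Im_complex_of_real Re_sum)
  qed
  define c where "c i j = a\<^sup>2 * S + a * b * ((m i)\<^sup>2 + (m j)\<^sup>2)" for i j
  have "cip y (L (rank_one x) *v y) = of_real (a\<^sup>2 * (\<Sum>i\<in>UNIV. \<Sum>j\<in>UNIV. S * g i j)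
      + a * b * (\<Sum>i\<in>UNIV. \<Sum>j\<in>UNIV. (m j)\<^sup>2 * g i j) + a * b * (\<Sum>i\<in>UNIV. \<Sum>j\<in>UNIV. (m i)\<^sup>2 * g i j)
      + b\<^sup>2 * (\<Sum>i\<in>UNIV. \<Sum>j\<in>UNIV. m i * m j * h i j))"
    unfolding shuffle_map_rank_one[OF assms(1) choi] X_def[symmetric] Y_def[symmetric] t1 t2 t3 t4
    by (simp only: of_real_add of_real_mult of_real_power)
  also have "a\<^sup>2 * (\<Sum>i\<in>UNIV. \<Sum>j\<in>UNIV. S * g i j)
      + a * b * (\<Sum>i\<in>UNIV. \<Sum>j\<in>UNIV. (m j)\<^sup>2 * g i j) + a * b * (\<Sum>i\<in>UNIV. \<Sum>j\<in>UNIV. (m i)\<^sup>2 * g i j)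
      + b\<^sup>2 * (\<Sum>i\<in>UNIV. \<Sum>j\<in>UNIV. m i * m j * h i j) =
      (\<Sum>i\<in>UNIV. \<Sum>j\<in>UNIV. c i j * g i j + b\<^sup>2 * (m i * m j * h i j))"
    unfolding sum_distrib_left sum.distrib[symmetric] by (intro sum.cong refl) (simp add: c_def algebra_simps)
  \<comment> \<open>The coefficient \<open>c\<close> is symmetric, so \<open>g\<close> may be
    averaged over the pair; this is what lets each summand be nonnegative by itself.\<close>
  also have "\<dots> = (\<Sum>i\<in>UNIV. \<Sum>j\<in>UNIV. c i j * ((g i j + g j i) / 2) + b\<^sup>2 * (m i * m j * h i j))"
  proof -
    have "(\<Sum>i\<in>UNIV. \<Sum>j\<in>UNIV. c i j * g i j) = (\<Sum>i\<in>UNIV. \<Sum>j\<in>UNIV. c i j * g j i)"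
      by (subst sum.swap) (simp add: c_def add.commute)
    then show ?thesis
      by (simp add: sum.distrib add_divide_distrib distrib_left sum_divide_distrib[symmetric])
  qed
  finally have form: "cip y (L (rank_one x) *v y) =
    of_real (\<Sum>i\<in>UNIV. \<Sum>j\<in>UNIV. c i j * ((g i j + g j i) / 2) + b\<^sup>2 * (m i * m j * h i j))" .
  have "0 \<le> c i j * ((g i j + g j i) / 2) + b\<^sup>2 * (m i * m j * h i j)" for i j
  proof (cases "i = j")
    case True
    \<comment> \<open>On the diagonal one singular value already bounds \<open>S\<close> from below,
      and the coefficients complete to the square \<open>(a + b)\<^sup>2\<close>.\<close>
    have "(m j)\<^sup>2 \<le> S"
      unfolding S_def by (rule member_le_sum) auto
    then have "a\<^sup>2 * (m j)\<^sup>2 \<le> a\<^sup>2 * S"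
      by (intro mult_left_mono) auto
    then have "0 \<le> c j j + b\<^sup>2 * (m j)\<^sup>2 - (a + b)\<^sup>2 * (m j)\<^sup>2"
      by (simp add: c_def power2_eq_square algebra_simps)
    moreover have "0 \<le> (a + b)\<^sup>2 * (m j)\<^sup>2"
      by simp
    ultimately have "0 \<le> c j j + b\<^sup>2 * (m j)\<^sup>2"
      by linarith
    then have "0 \<le> (c j j + b\<^sup>2 * (m j)\<^sup>2) * g j j"
      by (intro mult_nonneg_nonneg) (auto simp: g_def)
    moreover have "h j j = g j j"
      unfolding h_def g_def by (simp add: cmod_power2 power2_eq_square[of "Re _"] power2_eq_square[of "Im _"])
    ultimately show ?thesis
      using True by (simp add: power2_eq_square algebra_simps)
  next
    case False
    \<comment> \<open>Off the diagonal \<open>S\<close> exceeds both squares together. The mean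
      inequality and the hypothesis on \<open>b\<^sup>2\<close> then give
      \<open>b\<^sup>2 * (m i * m j) \<le> c i j\<close>, which absorbs the worst case of
      \<open>h i j\<close>.\<close>
    have "(m i)\<^sup>2 + (m j)\<^sup>2 = (\<Sum>k\<in>{i, j}. (m k)\<^sup>2)"
      using False by simp
    also have "\<dots> \<le> S"
      unfolding S_def by (rule sum_mono2) auto
    finally have "a\<^sup>2 * ((m i)\<^sup>2 + (m j)\<^sup>2) \<le> a\<^sup>2 * S"
      by (intro mult_left_mono) auto
    then have "a * (a + b) * ((m i)\<^sup>2 + (m j)\<^sup>2) \<le> c i j"
      by (simp add: c_def power2_eq_square algebra_simps)
    moreover have "a * (a + b) * (2 * m i * m j) \<le> a * (a + b) * ((m i)\<^sup>2 + (m j)\<^sup>2)"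
      using ab sum_squares_bound[of "m i" "m j"] by (intro mult_left_mono mult_nonneg_nonneg) auto
    moreover have "b\<^sup>2 * (m i * m j) \<le> 2 * a * (a + b) * (m i * m j)"
      using ab(4) m by (intro mult_right_mono mult_nonneg_nonneg) auto
    ultimately have "b\<^sup>2 * (m i * m j) \<le> c i j"
      by (simp add: mult_ac)
    moreover have gg: "0 \<le> (g i j + g j i) / 2"
      by (simp add: g_def)
    ultimately have "b\<^sup>2 * (m i * m j) * ((g i j + g j i) / 2) \<le> c i j * ((g i j + g j i) / 2)"
      by (rule mult_right_mono)
    moreover have "- h i j \<le> (g i j + g j i) / 2"
    proof -
      have "- h i j \<le> cmod (N $ i $ j) * cmod (N $ j $ i)"
        unfolding h_def using abs_Re_le_cmod[of "N $ i $ j * cnj (N $ j $ i)"]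
        by (simp only: norm_mult complex_mod_cnj)
      then show ?thesis
        using sum_squares_bound[of "cmod (N $ i $ j)" "cmod (N $ j $ i)"] by (simp add: g_def)
    qed
    then have "b\<^sup>2 * (m i * m j) * (- h i j) \<le> b\<^sup>2 * (m i * m j) * ((g i j + g j i) / 2)"
      using m by (intro mult_left_mono mult_nonneg_nonneg) auto
    ultimately show ?thesis
      by (simp add: mult_ac)
  qed
  then show "cip y (L (rank_one x) *v y) \<in> \<real>\<^sub>\<ge>\<^sub>0"
    unfolding form nonneg_Reals_of_real_iff by (intro sum_nonneg)
qed

section \<open>Necessity of the positivity condition, by explicit vectors\<close>

lemma matrix_unit_mult: "matrix_unit a b ** matrix_unit c e = (if b = c then matrix_unit a e else 0)"
proof -
  have "(matrix_unit a b ** matrix_unit c e) $ i $ j =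
      (\<Sum>k\<in>UNIV. if k = b then if i = a \<and> j = e \<and> b = c then 1 else 0 else 0)" for i j
    unfolding matrix_matrix_mult_def vec_lambda_beta matrix_unit_nth by (intro sum.cong refl) auto
  then show ?thesis by (auto simp: vec_eq_iff)
qed

lemma trace_matrix_unit: "trace (matrix_unit a b) = (if a = b then 1 else 0)"
proof -
  have "trace (matrix_unit a b) = (\<Sum>k\<in>UNIV. if k = a then if a = b then 1 else 0 else 0)"
    unfolding trace_def matrix_unit_nth by (intro sum.cong refl) auto
  then show ?thesis by simp
qed

lemma shuffle_map_positive_bound:
  fixes L :: "('n::finite \<times> 'n) cmat \<Rightarrow> ('n \<times> 'n) cmat"
  assumes "positive_map L" and "CARD('n) \<ge> 2"
    and choi: "choi L = shuffle (a *\<^sub>R mat 1 + b *\<^sub>R flip_mat :: ('n \<times> 'n) cmat) (a *\<^sub>R mat 1 + b *\<^sub>R max_ent)"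
  shows "b\<^sup>2 \<le> 2 * a * (a + b)"
proof -
  have lin: "complex_linear L"
    using assms(1) by (simp add: positive_map_def)
  have "\<not> (\<forall>u v :: 'n. u = v)"
    using assms(2) card_le_Suc0_iff_eq[of "UNIV :: 'n set"] by auto
  then obtain u v :: 'n where uv: "u \<noteq> v" "v \<noteq> u"
    by blast
  \<comment> \<open>This choice makes the off-diagonal estimates sharp: two equal singular values
    exhaust \<open>S\<close>, and the two entries of \<open>Y\<close> have equal modulus and
    opposite sign. Only the inequality to be proved remains.\<close>
  define X :: "'n cmat" where "X = matrix_unit u u + matrix_unit v v"
  define Y :: "'n cmat" where "Y = matrix_unit u v - matrix_unit v u"
  define x where "x = (\<chi> p. X $ fst p $ snd p)"
  define y where "y = (\<chi> p. Y $ fst p $ snd p)"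
  have xy: "mat_of_vec x = X" "mat_of_vec y = Y"
    by (simp_all add: vec_eq_iff x_def y_def)
  have "psd (L (rank_one x))"
    using assms(1) psd_rank_one by (auto simp: positive_map_def)
  then have "cip y (L (rank_one x) *v y) \<in> \<real>\<^sub>\<ge>\<^sub>0"
    by (simp add: psd_cip)
  moreover have "cip y (L (rank_one x) *v y) = of_real (2 * (2 * a * (a + b) - b\<^sup>2))"
  proof -
    have D: "dagger X = X" "transpose X = X" "dagger Y = - Y" "cnj_mat Y = Y"
      using uv by (auto simp: X_def Y_def vec_eq_iff transpose_def)
    have mult: "Y ** X = Y" "X ** Y = Y" "X ** X = X" "Y ** Y = - X"
      using uv by (simp_all add: X_def Y_def matrix_add_ldistrib mult_add_mat mult_diff_mat mult_mat_diff matrix_unit_mult)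
    have neg: "Y ** (- Y) = X"
    proof -
      have "Y ** (0 - Y) = 0 - Y ** Y"
        unfolding mult_mat_diff by (simp add: matrix_matrix_mult_def vec_eq_iff)
      then show ?thesis by (simp add: mult)
    qed
    have tr: "trace X = 2" "trace (- X) = - 2"
      using trace_sub[of 0 X] by (simp_all add: X_def trace_add trace_matrix_unit trace_def[of 0])
    show ?thesis
      unfolding shuffle_map_rank_one[OF lin choi] xy D mult neg tr
      by (simp add: power2_eq_square algebra_simps)
  qed
  ultimately have "0 \<le> 2 * (2 * a * (a + b) - b\<^sup>2)"
    by (simp only: nonneg_Reals_of_real_iff)
  then show ?thesis
    by simp
qed

subsection \<open>The thresholds\<close>

lemma choi_werner_map_eq:
  fixes p :: real
  defines "d \<equiv> real CARD('n::finite)"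
  defines "s \<equiv> 2 * p / (d * (d + 1))" and "r \<equiv> 2 * (1 - p) / (d * (d - 1))"
  shows "choi (werner_map p :: 'n cmat \<Rightarrow> 'n cmat) = ((s + r) / 2) *\<^sub>R mat 1 + ((s - r) / 2) *\<^sub>R flip_mat"
proof -
  have "x *\<^sub>R ((1/2) *\<^sub>R (A + B)) + y *\<^sub>R ((1/2) *\<^sub>R (A - B)) = ((x + y) / 2) *\<^sub>R A + ((x - y) / 2) *\<^sub>R B"
    for x y :: real and A B :: "('n \<times> 'n) cmat"
    by (simp add: algebra_simps add_divide_distrib diff_divide_distrib)
  moreover have "p / d_sym CARD('n) = s" "(1 - p) / d_asym CARD('n) = r"
    by (simp_all add: d_sym_def d_asym_def s_def r_def d_def)
  ultimately show ?thesis
    unfolding choi_werner_map werner_state_def P_sym_def P_asym_def by simp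
qed

text \<open>A common positive factor is split off, so comparing multiples of the two eigenvalues
  becomes a comparison linear in \<open>p\<close>.\<close>

lemma werner_weights:
  fixes p d :: real
  assumes "d > 2"
  shows "2 * p / (d * (d + 1)) = 2 / (d * (d - 1) * (d + 1)) * (p * (d - 1))"
    and "2 * (1 - p) / (d * (d - 1)) = 2 / (d * (d - 1) * (d + 1)) * ((1 - p) * (d + 1))"
proof -
  have "d \<noteq> 0" "d - 1 \<noteq> 0" "d + 1 \<noteq> 0"
    using assms by auto
  then show "2 * p / (d * (d + 1)) = 2 / (d * (d - 1) * (d + 1)) * (p * (d - 1))"
    and "2 * (1 - p) / (d * (d - 1)) = 2 / (d * (d - 1) * (d + 1)) * ((1 - p) * (d + 1))"
    by simp_all
qed

text \<open>Up to a positive factor the expression is the difference of squares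
  \<open>(p * k)\<^sup>2 - (1 - 2 * p)\<^sup>2\<close> with
  \<open>k = sqrt (2 * d / (d + 1))\<close>, and comparing the roots is linear in
  \<open>p\<close>.\<close>

lemma werner_decomposable_threshold:
  fixes p d :: real
  assumes d: "d > 2" and p: "0 \<le> p" "p \<le> 1"
  defines "s \<equiv> 2 * p / (d * (d + 1))" and "r \<equiv> 2 * (1 - p) / (d * (d - 1))"
  shows "r * ((s + r) / 2 + (s - r) / 2 * d) + (d + 1) * s * ((s + r) / 2) < 0 \<longleftrightarrow>
    p < 1 / (2 + sqrt (2 * d / (d + 1)))"
proof -
  define k where "k = sqrt (2 * d / (d + 1))"
  have k2: "k\<^sup>2 = 2 * d / (d + 1)"
    using d by (simp add: k_def)
  have k: "k \<ge> 1"
    unfolding k_def using d by (simp add: field_simps)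
  have "d \<noteq> 0" "d - 1 \<noteq> 0" "d + 1 \<noteq> 0"
    using d by auto
  then have "r * ((s + r) / 2 + (s - r) / 2 * d) + (d + 1) * s * ((s + r) / 2) =
      2 / (d\<^sup>2 * (d - 1)) * (p\<^sup>2 * (2 * d / (d + 1)) - (1 - 2 * p)\<^sup>2)"
    unfolding s_def r_def by (simp add: divide_simps) algebra
  also have "\<dots> < 0 \<longleftrightarrow> p\<^sup>2 * (2 * d / (d + 1)) < (1 - 2 * p)\<^sup>2"
  proof -
    have "0 < 2 / (d\<^sup>2 * (d - 1))"
      using d by simp
    then have "2 / (d\<^sup>2 * (d - 1)) * x < 0 \<longleftrightarrow> x < 0" for x
      by (simp only: mult_less_0_iff) auto
    then show ?thesis
      by (simp only: diff_less_0_iff_less)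
  qed
  also have "\<dots> \<longleftrightarrow> (p * k)\<^sup>2 < (1 - 2 * p)\<^sup>2"
    by (simp add: power_mult_distrib k2)
  also have "\<dots> \<longleftrightarrow> p * k < 1 - 2 * p"
  proof
    assume "(p * k)\<^sup>2 < (1 - 2 * p)\<^sup>2"
    then have "p * k < \<bar>1 - 2 * p\<bar>"
      using power2_le_iff_abs_le by (metis abs_ge_self abs_le_square_iff not_le order_trans)
    \<comment> \<open>This rules out a negative \<open>1 - 2 * p\<close>, whose modulus
      \<open>2 * p - 1\<close> is at most \<open>p\<close> and so at most
      \<open>p * k\<close>.\<close>
    moreover have "p \<le> p * k"
      using k p by (simp add: mult_le_cancel_left1)
    ultimately show "p * k < 1 - 2 * p"
      using p by linarith
  next
    assume "p * k < 1 - 2 * p"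
    then show "(p * k)\<^sup>2 < (1 - 2 * p)\<^sup>2"
      using k p by (intro power_strict_mono) auto
  qed
  also have "\<dots> \<longleftrightarrow> p < 1 / (2 + k)"
    using k by (simp add: field_simps)
  finally show ?thesis
    unfolding k_def .
qed

text \<open>Four times the difference of the two sides is
  \<open>3 * s\<^sup>2 + 6 * s * r - r\<^sup>2\<close>, which factors with the help of
  \<open>sqrt 3\<close>. One factor is nonnegative, so the other decides, and it is linear in
  \<open>p\<close>.\<close>

lemma werner_positive_threshold:
  fixes p d :: real
  assumes d: "d > 2" and p: "0 \<le> p" "p \<le> 1"
  defines "s \<equiv> 2 * p / (d * (d + 1))" and "r \<equiv> 2 * (1 - p) / (d * (d - 1))"
  shows "((s - r) / 2)\<^sup>2 \<le> 2 * ((s + r) / 2) * ((s + r) / 2 + (s - r) / 2) \<longleftrightarrow>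
    (2 - sqrt 3) * (d + 1) / (2 * (d + 1 - sqrt 3)) \<le> p"
proof -
  define q where "q = sqrt (3 :: real)"
  have q: "q * q = 3" "q < 2" "0 < q"
    by (simp_all add: q_def real_less_lsqrt)
  have s0: "0 \<le> s" and r0: "0 \<le> r"
    using d p by (simp_all add: s_def r_def)
  have "((s - r) / 2)\<^sup>2 \<le> 2 * ((s + r) / 2) * ((s + r) / 2 + (s - r) / 2) \<longleftrightarrow>
      0 \<le> ((3 + 2 * q) * s - r) * (r + (2 * q - 3) * s)"
  proof -
    have "4 * (2 * ((s + r) / 2) * ((s + r) / 2 + (s - r) / 2) - ((s - r) / 2)\<^sup>2) = 3 * s\<^sup>2 + 6 * s * r - r\<^sup>2"
      by (simp add: field_simps power2_eq_square)
    also have "\<dots> = 4 * (q * q) * s\<^sup>2 - (3 * s - r)\<^sup>2"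
      unfolding q(1) by (simp add: power2_eq_square algebra_simps)
    also have "\<dots> = ((3 + 2 * q) * s - r) * (r + (2 * q - 3) * s)"
      by (simp add: power2_eq_square algebra_simps)
    finally have *: "4 * (2 * ((s + r) / 2) * ((s + r) / 2 + (s - r) / 2) - ((s - r) / 2)\<^sup>2) =
        ((3 + 2 * q) * s - r) * (r + (2 * q - 3) * s)" .
    have "x \<le> y \<longleftrightarrow> 0 \<le> 4 * (y - x)" for x y :: real
      by auto
    then show ?thesis
      unfolding *[symmetric] .
  qed
  also have "\<dots> \<longleftrightarrow> r \<le> (3 + 2 * q) * s"
  proof -
    have "3 / 2 < q"
      unfolding q_def by (rule real_less_rsqrt) (simp add: power2_eq_square)
    then have nn: "0 \<le> (2 * q - 3) * s"
      using s0 by simp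
    show ?thesis
    proof
      assume *: "0 \<le> ((3 + 2 * q) * s - r) * (r + (2 * q - 3) * s)"
      show "r \<le> (3 + 2 * q) * s"
      proof (rule ccontr)
        assume "\<not> r \<le> (3 + 2 * q) * s"
        moreover have "0 \<le> (3 + 2 * q) * s"
          using s0 q by simp
        ultimately have "((3 + 2 * q) * s - r) * (r + (2 * q - 3) * s) < 0"
          using nn by (intro mult_neg_pos) auto
        with * show False by simp
      qed
    next
      assume "r \<le> (3 + 2 * q) * s"
      then show "0 \<le> ((3 + 2 * q) * s - r) * (r + (2 * q - 3) * s)"
        using nn r0 by simp
    qed
  qed
  also have "\<dots> \<longleftrightarrow> (1 - p) * (d + 1) \<le> (3 + 2 * q) * p * (d - 1)"
  proof -
    have "r = 2 / (d * (d - 1) * (d + 1)) * ((1 - p) * (d + 1))"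
      and "(3 + 2 * q) * s = 2 / (d * (d - 1) * (d + 1)) * ((3 + 2 * q) * p * (d - 1))"
      unfolding s_def r_def werner_weights[OF d] by simp_all
    moreover have "0 < 2 / (d * (d - 1) * (d + 1))"
      using d by simp
    ultimately show ?thesis
      by (simp only: mult_le_cancel_left_pos)
  qed
  \<comment> \<open>Since \<open>(2 + q) * (2 - q) = 1\<close>, extracting the factor
    \<open>2 + q\<close> brings the bound into the stated form.\<close>
  also have "\<dots> \<longleftrightarrow> (2 + q) * ((2 - q) * (d + 1)) \<le> (2 + q) * (p * (2 * (d + 1 - q)))"
  proof -
    have "(2 + q) * (p * (2 * (d + 1 - q))) - (2 + q) * ((2 - q) * (d + 1)) =
        p * (4 * d + 4 - 2 * q + 2 * q * d - 2 * (q * q)) - (4 - q * q) * (d + 1)"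
      by (simp add: algebra_simps)
    also have "\<dots> = (3 + 2 * q) * p * (d - 1) - (1 - p) * (d + 1)"
      unfolding q(1) by (simp add: algebra_simps)
    finally have "(2 + q) * (p * (2 * (d + 1 - q))) - (2 + q) * ((2 - q) * (d + 1)) =
        (3 + 2 * q) * p * (d - 1) - (1 - p) * (d + 1)" .
    moreover have "x \<le> y \<longleftrightarrow> x' \<le> y'" if "y' - x' = y - x" for x y x' y' :: real
      using that by auto
    ultimately show ?thesis by blast
  qed
  also have "\<dots> \<longleftrightarrow> (2 - q) * (d + 1) \<le> p * (2 * (d + 1 - q))"
    using q by (intro mult_le_cancel_left_pos) auto
  also have "\<dots> \<longleftrightarrow> (2 - q) * (d + 1) / (2 * (d + 1 - q)) \<le> p"
    using d q by (simp add: pos_divide_le_eq)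
  finally show ?thesis
    unfolding q_def .
qed

theorem theorem6p1:
  fixes W :: "'n::finite cmat \<Rightarrow> 'n cmat" and d :: nat and p :: real
  assumes "d = CARD('n)" and "d > 2"
    and "0 \<le> p" and "p \<le> 1"
    and "W = werner_map p"
  shows "positive_map (tensor_map W (transpose \<circ> W)) \<and>
         \<not> decomposable (tensor_map W (transpose \<circ> W)) \<longleftrightarrow>
         (2 - sqrt 3) * (real d + 1) / (2 * (real d + 1 - sqrt 3)) \<le> p \<and>
         p < 1 / (2 + sqrt (2 * real d / (real d + 1)))"
proof -
  define L where "L = tensor_map W (transpose \<circ> W)"
  define s where "s = 2 * p / (real d * (real d + 1))"
  define r where "r = 2 * (1 - p) / (real d * (real d - 1))"
  define a where "a = (s + r) / 2"
  define b where "b = (s - r) / 2"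
  have d2: "real d > 2" "real CARD('n) = real d"
    using assms(1,2) by auto
  have "0 \<le> s" "0 \<le> r"
    using d2(1) assms(3,4) by (simp_all add: s_def r_def)
  have lin: "complex_linear L"
    unfolding L_def by (rule complex_linear_tensor_map)
  have linW: "complex_linear W"
    unfolding assms(5) by (rule complex_linear_werner_map)
  have choiW: "choi W = a *\<^sub>R mat 1 + b *\<^sub>R flip_mat"
    unfolding assms(5) choi_werner_map_eq a_def b_def s_def r_def assms(1) ..
  \<comment> \<open>The transposition after the second \<open>W\<close> turns its flip into
    \<open>max_ent\<close>.\<close>
  have choi: "choi L = shuffle (a *\<^sub>R mat 1 + b *\<^sub>R flip_mat :: ('n \<times> 'n) cmat) (a *\<^sub>R mat 1 + b *\<^sub>R max_ent)"
    unfolding L_def comp_def choi_tensor_map[OF linW complex_linear_transpose[OF linW]] choi_transpose choiW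
      partial_transpose_add partial_transpose_scaleR partial_transpose_flip partial_transpose_mat ..
  have pos: "(2 - sqrt 3) * (real d + 1) / (2 * (real d + 1 - sqrt 3)) \<le> p \<longleftrightarrow> b\<^sup>2 \<le> 2 * a * (a + b)"
    using werner_positive_threshold[OF d2(1) assms(3,4)] unfolding a_def b_def s_def r_def by (rule sym)
  have dec: "p < 1 / (2 + sqrt (2 * real d / (real d + 1))) \<longleftrightarrow> r * (a + b * real d) + (real d + 1) * s * a < 0"
    using werner_decomposable_threshold[OF d2(1) assms(3,4)] unfolding a_def b_def s_def r_def by (rule sym)
  \<comment> \<open>The explicit decomposition and the witness cover complementary signs of the same
    expression, so the criterion is exact.\<close>
  have nondecomposable: "\<not> decomposable L \<longleftrightarrow> r * (a + b * real d) + (real d + 1) * s * a < 0"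
  proof
    assume "\<not> decomposable L"
    then show "r * (a + b * real d) + (real d + 1) * s * a < 0"
      using shuffle_werner_decomposition[where 'n = 'n and s = s and r = r] d2 \<open>0 \<le> s\<close> \<open>0 \<le> r\<close>
      unfolding decomposable_iff_choi[OF lin] choi d2(2) a_def[symmetric] b_def[symmetric] by force
  next
    assume "r * (a + b * real d) + (real d + 1) * s * a < 0"
    then show "\<not> decomposable L"
      using shuffle_werner_no_decomposition[where 'n = 'n and s = s and r = r] d2
      unfolding decomposable_iff_choi[OF lin] choi d2(2) a_def[symmetric] b_def[symmetric] by force
  qed
  have "b\<^sup>2 \<le> 2 * a * (a + b)" if "positive_map L"
    using shuffle_map_positive_bound[OF that _ choi] assms(1,2) by simp
  \<comment> \<open>The pairwise estimate needs \<open>b \<le> 0\<close>. The upper bound on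
    \<open>p\<close> supplies it: it forces \<open>p \<le> 1 / 2\<close> and thereby
    \<open>s \<le> r\<close>.\<close>
  moreover have "positive_map L" if "b\<^sup>2 \<le> 2 * a * (a + b)" "p < 1 / (2 + sqrt (2 * real d / (real d + 1)))"
  proof (rule positive_map_if_rank_one[OF lin], rule shuffle_map_psd_rank_one[OF lin choi _ _ _ that(1)])
    have "1 / (2 + sqrt (2 * real d / (real d + 1))) \<le> 1 / 2"
      by (intro divide_left_mono) (auto simp: add_pos_nonneg)
    then have "p \<le> 1 / 2"
      using that(2) by simp
    then have "p * (real d - 1) \<le> (1 - p) * (real d + 1)"
      using d2(1) assms(3,4) by (intro mult_mono) auto
    then have "s \<le> r"
    proof -
      have "s = 2 / (real d * (real d - 1) * (real d + 1)) * (p * (real d - 1))"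
        and "r = 2 / (real d * (real d - 1) * (real d + 1)) * ((1 - p) * (real d + 1))"
        unfolding s_def r_def by (fact werner_weights[OF d2(1)])+
      then show ?thesis
        using \<open>p * (real d - 1) \<le> (1 - p) * (real d + 1)\<close> d2(1)
        by (simp only:) (intro mult_left_mono, auto)
    qed
    then show "b \<le> 0"
      by (simp add: b_def)
    show "0 \<le> a" "0 \<le> a + b"
      using \<open>0 \<le> s\<close> \<open>0 \<le> r\<close> by (simp_all add: a_def b_def field_simps)
  qed
  ultimately show ?thesis
    unfolding L_def[symmetric] pos using dec nondecomposable by blast
qed

end
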